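(* Fix $\sigma^2>0$ and a measurable $f:\mathbb R\to\mathbb R$ with $\mathrm E[f(x)^2]=1$ for $x\sim\mathcal N(0,1)$; let $y=f(x)+n$ with $n\sim\mathcal N(0,\sigma^2)$ independent of $x$. For $\delta>0$ and $v\in(0,1]$ let $\varphi_\delta(v)=\frac{\delta}{v}\big(1-\frac{\mathrm{mmse}(x|\hat p,y)}{v}\big)$, where $(x,\hat p)$ is jointly Gaussian with zero mean, $\mathrm{Var}(x)=1$, $\mathrm{Var}(\hat p)=\mathrm{Cov}(x,\hat p)=1-v$, $\hat p\to x\to y$ is Markov, and $\mathrm{mmse}(x|\hat p,y)=\mathrm E[(x-\mathrm E[x\mid\hat p,y])^2]$. Assume $\varphi_\delta$ is positive and strictly decreasing on $(0,1]$, and let $\varphi_\delta^{-1}:[0,\infty)\to[0,1]$ be its extended inverse ($\varphi_\delta^{-1}(\rho)=1$ for $\rho<\varphi_\delta(1)$, $\varphi_\delta^{-1}(\varphi_\delta(v))=v$, and $\varphi_\delta^{-1}(\rho)=0$ for $\rho\ge\sup_{v}\varphi_\delta(v)$). Let $\mathcal S_C\subset\mathbb R$ be a finite symmetric constellation used with equal probabilities and unit average power, let $\psi^{opt}_f(\rho)=\min\{\varphi_\delta^{-1}(\rho),\mathrm{mmse}(\mathcal S_C,\rho)\}$, $$a_f(\delta)=\int_0^\infty\big(\varphi_\delta^{-1}(\rho)-\psi^{opt}_f(\rho)\big)\mathrm d\rho,\qquad R_{\mathrm{AC}}(\delta)=I(y;x)-\frac{a_f(\delta)}{2\delta}.$$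 Then $R_{\mathrm{AC}}(\delta)\to I(y;x)$ as $\delta\to0$.
   Context: $\mathrm{mmse}(\mathcal S,\rho)$ denotes the minimum mean-squared error of estimating $s$, drawn uniformly from $\mathcal S$, from $\sqrt\rho\,s+w$ with $w\sim\mathcal N(0,1)$ independent of $s$. Mutual information is in nats. By the area property $\frac12\int_0^1\varphi_\delta=\delta I(y;x)$, $R_{\mathrm{AC}}(\delta)=\frac1{2\delta}\int_0^\infty\psi^{opt}_f(\rho)\mathrm d\rho$ is the rate of a generalized compressed coding scheme whose decoder transfer curve satisfies the matching condition $\psi=\psi_f^{opt}$; $\delta\to0$ is taken jointly with the underlying code rate $R_{\mathrm C}=\delta R_{\mathrm{AC}}\to0$. *)

theory Defs
  imports "HOL-Probability.Probability"
begin

definition gauss :: "real \<Rightarrow> real measure" where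
  "gauss s = density lborel (normal_density 0 s)"

definition gen_alg :: "'a measure \<Rightarrow> ('a \<Rightarrow> 'b) \<Rightarrow> 'b measure \<Rightarrow> 'a measure" where
  "gen_alg M Z N = vimage_algebra (space M) Z N"

definition chan_space :: "real \<Rightarrow> (real \<times> real \<times> real) measure" where
  "chan_space \<sigma> = gauss 1 \<Otimes>\<^sub>M (gauss 1 \<Otimes>\<^sub>M gauss \<sigma>)"

(* x, phat, y as random variables on chan_space.
   phat = (1-v) x + sqrt (v(1-v)) z gives (x,phat) jointly Gaussian, zero mean,
   Var x = 1, Var phat = Cov(x,phat) = 1 - v, and phat -> x -> y Markov. *)
definition rv_x :: "real \<times> real \<times> real \<Rightarrow> real" where
  "rv_x \<omega> = fst \<omega>"

definition rv_phat :: "real \<Rightarrow> real \<times> real \<times> real \<Rightarrow> real" where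
  "rv_phat v \<omega> = (1 - v) * fst \<omega> + sqrt (v * (1 - v)) * fst (snd \<omega>)"

definition rv_y :: "(real \<Rightarrow> real) \<Rightarrow> real \<times> real \<times> real \<Rightarrow> real" where
  "rv_y f \<omega> = f (fst \<omega>) + snd (snd \<omega>)"

definition mmse_xpy :: "real \<Rightarrow> (real \<Rightarrow> real) \<Rightarrow> real \<Rightarrow> real" where
  "mmse_xpy \<sigma> f v =
     (let M = chan_space \<sigma>;
          F = gen_alg M (\<lambda>\<omega>. (rv_phat v \<omega>, rv_y f \<omega>)) (borel :: (real \<times> real) measure)
      in \<integral>\<omega>. (rv_x \<omega> - real_cond_exp M F rv_x \<omega>)\<^sup>2 \<partial>M)"

definition phi :: "real \<Rightarrow> (real \<Rightarrow> real) \<Rightarrow> real \<Rightarrow> real \<Rightarrow> real" where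
  "phi \<sigma> f \<delta> v = \<delta> / v * (1 - mmse_xpy \<sigma> f v / v)"

(* Extended inverse of a function g that is positive and strictly decreasing on (0,1]:
   equals 1 below g 1, equals v at g v, equals 0 at or above sup g. *)
definition ext_inv :: "(real \<Rightarrow> real) \<Rightarrow> real \<Rightarrow> real" where
  "ext_inv g \<rho> = Sup ({0} \<union> {v \<in> {0<..1}. g v > \<rho>})"

definition const_space :: "real set \<Rightarrow> (real \<times> real) measure" where
  "const_space S = measure_pmf (pmf_of_set S) \<Otimes>\<^sub>M gauss 1"

definition mmse_const :: "real set \<Rightarrow> real \<Rightarrow> real" where
  "mmse_const S \<rho> =
     (let M = const_space S;
          F = gen_alg M (\<lambda>\<omega>. sqrt \<rho> * fst \<omega> + snd \<omega>) (borel :: real measure)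
      in \<integral>\<omega>. (fst \<omega> - real_cond_exp M F fst \<omega>)\<^sup>2 \<partial>M)"

definition mi_yx :: "real \<Rightarrow> (real \<Rightarrow> real) \<Rightarrow> real" where
  "mi_yx \<sigma> f =
     prob_space.mutual_information (gauss 1 \<Otimes>\<^sub>M gauss \<sigma>) (exp 1) borel borel
       (\<lambda>\<omega>. f (fst \<omega>) + snd \<omega>) fst"

definition psi_opt :: "real \<Rightarrow> (real \<Rightarrow> real) \<Rightarrow> real set \<Rightarrow> real \<Rightarrow> real \<Rightarrow> real" where
  "psi_opt \<sigma> f S \<delta> \<rho> = min (ext_inv (phi \<sigma> f \<delta>) \<rho>) (mmse_const S \<rho>)"

definition a_integrand :: "real \<Rightarrow> (real \<Rightarrow> real) \<Rightarrow> real set \<Rightarrow> real \<Rightarrow> real \<Rightarrow> real" where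
  "a_integrand \<sigma> f S \<delta> \<rho> = ext_inv (phi \<sigma> f \<delta>) \<rho> - psi_opt \<sigma> f S \<delta> \<rho>"

definition a_f :: "real \<Rightarrow> (real \<Rightarrow> real) \<Rightarrow> real set \<Rightarrow> real \<Rightarrow> real" where
  "a_f \<sigma> f S \<delta> = (LINT \<rho>:{0..}|lborel. a_integrand \<sigma> f S \<delta> \<rho>)"

definition R_AC :: "real \<Rightarrow> (real \<Rightarrow> real) \<Rightarrow> real set \<Rightarrow> real \<Rightarrow> real" where
  "R_AC \<sigma> f S \<delta> = mi_yx \<sigma> f - a_f \<sigma> f S \<delta> / (2 * \<delta>)"

end

theory Submission
  imports Defs
begin

text \<open>
  By scaling, \<open>a\<^sub>f(\<delta>) / \<delta>\<close> is the integral over \<open>t \<ge> 0\<close> of \<open>g(t) - min(g(t), mmse(S, \<delta> t))\<close>, where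
  \<open>g\<close> is the extended inverse of \<open>\<phi>\<^sub>1\<close>. As \<open>\<delta> \<rightarrow> 0\<close> the integrand tends to \<open>0\<close>, because \<open>mmse(S, \<cdot>)\<close> is
  continuous with value \<open>1 \<ge> g\<close> at \<open>0\<close>; dominated convergence applies once \<open>g\<close> is integrable. By
  monotonicity this only needs \<open>\<Sum> v\<^sub>i \<phi>\<^sub>1(v\<^sub>i) < \<infinity>\<close> along \<open>v\<^sub>i = 2\<^bsup>-(i+1)\<^esup>\<close>. Let \<open>H(v)\<close> be the relative
  entropy (information about \<open>y\<close>) carried by \<open>phat\<close> at parameter \<open>v\<close>. The Gibbs variational inequality, tested
  against exponentials of linear functions of the Gaussian increment of \<open>phat\<close>, gives
  \<open>H(v') \<ge> H(v) + (v - v') \<phi>\<^sub>1(v) / 2\<close> for \<open>v' < v\<close>. Telescoping bounds the sum by \<open>H(0)\<close>, which is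
  finite since \<open>f(x)\<close> is square integrable.
\<close>

subsection \<open>Gaussian measures\<close>

lemma sets_gauss [simp, measurable_cong]: "sets (gauss s) = sets borel"
  by (simp add: gauss_def)

lemma space_gauss [simp]: "space (gauss s) = UNIV"
  by (simp add: gauss_def)

lemma prob_space_gauss: "s > 0 \<Longrightarrow> prob_space (gauss s)"
  unfolding gauss_def by (rule prob_space_normal_density)

lemma emeasure_gauss_UNIV [simp]: "s > 0 \<Longrightarrow> emeasure (gauss s) UNIV = 1"
  using prob_space.emeasure_space_1[OF prob_space_gauss] by simp

lemma nn_integral_gauss:
  assumes [measurable]: "h \<in> borel_measurable borel"
  shows "(\<integral>\<^sup>+x. h x \<partial>gauss s) = (\<integral>\<^sup>+x. ennreal (normal_density 0 s x) * h x \<partial>lborel)"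
  unfolding gauss_def by (subst nn_integral_density) auto

lemma gauss_scale:
  assumes c: "c > 0"
  shows "gauss c = distr (gauss 1) borel (\<lambda>x. c * x)"
proof (rule measure_eqI)
  fix A assume "A \<in> sets (gauss c)"
  then have A[measurable]: "A \<in> sets borel" by simp
  have d: "c * normal_density 0 c (c * x) = normal_density 0 1 x" for x
    using c by (simp add: normal_density_def power_mult_distrib real_sqrt_mult field_simps)
  have "emeasure (gauss c) A = (\<integral>\<^sup>+x. indicator A x \<partial>gauss c)"
    by simp
  also have "\<dots> = (\<integral>\<^sup>+x. ennreal (normal_density 0 c x) * indicator A x \<partial>lborel)"
    by (rule nn_integral_gauss) simp
  also have "\<dots> = ennreal \<bar>c\<bar> * (\<integral>\<^sup>+x. ennreal (normal_density 0 c (0 + c * x)) * indicator A (0 + c * x) \<partial>lborel)"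
    using c by (subst nn_integral_real_affine[where c = c and t = 0]) auto
  also have "\<dots> = (\<integral>\<^sup>+x. ennreal c * (ennreal (normal_density 0 c (c * x)) * indicator A (c * x)) \<partial>lborel)"
    using c by (subst nn_integral_cmult) auto
  also have "\<dots> = (\<integral>\<^sup>+x. ennreal (normal_density 0 1 x) * indicator A (c * x) \<partial>lborel)"
    using c by (simp add: mult.assoc[symmetric] ennreal_mult[symmetric] d)
  also have "\<dots> = (\<integral>\<^sup>+x. indicator A (c * x) \<partial>gauss 1)"
    by (rule nn_integral_gauss[symmetric]) simp
  also have "\<dots> = (\<integral>\<^sup>+x. indicator A x \<partial>distr (gauss 1) borel (\<lambda>x. c * x))"
    by (subst nn_integral_distr) auto
  also have "\<dots> = emeasure (distr (gauss 1) borel (\<lambda>x. c * x)) A"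
    by simp
  finally show "emeasure (gauss c) A = emeasure (distr (gauss 1) borel (\<lambda>x. c * x)) A" .
qed simp

text \<open>Rotation invariance of the planar standard Gaussian, by two one-dimensional
  substitutions instead of a planar one: \<open>x\<close> is replaced by \<open>u\<close> at fixed
  \<open>z\<close>, then \<open>z\<close> by \<open>p\<close> at fixed \<open>u\<close>. Their
  factors \<open>1/s\<close> and \<open>s\<close> cancel.\<close>

lemma nn_integral_gauss_rotation:
  fixes s c :: real
  assumes sc: "s\<^sup>2 + c\<^sup>2 = 1" and s: "s > 0"
    and [measurable]: "h \<in> borel_measurable (borel \<Otimes>\<^sub>M borel)"
  shows "(\<integral>\<^sup>+z. \<integral>\<^sup>+x. h (s * x - c * z, c * x + s * z) \<partial>gauss 1 \<partial>gauss 1)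
       = (\<integral>\<^sup>+u. \<integral>\<^sup>+p. h (u, p) \<partial>gauss 1 \<partial>gauss 1)"
proof -
  let ?n = "\<lambda>x. normal_density 0 1 x :: real"
  have [measurable]: "(\<lambda>x. h (f x, g x)) \<in> borel_measurable M"
    if [measurable]: "f \<in> borel_measurable M" "g \<in> borel_measurable M" for M :: "'a measure" and f g
    by (rule measurable_compose[OF measurable_Pair]) measurable
  have nn: "?n x * ?n z = exp (- (x\<^sup>2 + z\<^sup>2) / 2) / (2 * pi)" for x z
    by (simp add: std_normal_density_def exp_add[symmetric] field_simps)
  \<comment> \<open>The new arguments are the old \<open>x\<close> and the new \<open>p\<close>
    written through the mixed pair \<open>(u, z)\<close>; the products agree because a rotation
    preserves the sum of squares.\<close>
  have rot: "?n ((u + c * z) / s) * ?n z = ?n u * ?n ((c * u + z) / s)" for u z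
  proof -
    have "((u + c * z) / s)\<^sup>2 + z\<^sup>2 = u\<^sup>2 + ((c * u + z) / s)\<^sup>2"
    proof -
      have "(u + c * z)\<^sup>2 + s\<^sup>2 * z\<^sup>2 = s\<^sup>2 * u\<^sup>2 + (c * u + z)\<^sup>2"
        using sc by algebra
      then show ?thesis using s by (simp add: power_divide field_simps)
    qed
    then show ?thesis unfolding nn by simp
  qed
  have "(\<integral>\<^sup>+z. \<integral>\<^sup>+x. h (s * x - c * z, c * x + s * z) \<partial>gauss 1 \<partial>gauss 1)
      = (\<integral>\<^sup>+z. \<integral>\<^sup>+x. ennreal (?n x * ?n z) * h (s * x - c * z, c * x + s * z) \<partial>lborel \<partial>lborel)"
    by (simp add: nn_integral_gauss nn_integral_cmult[symmetric] ennreal_mult' mult_ac)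
  also have "\<dots> = (\<integral>\<^sup>+z. ennreal (1/s) * (\<integral>\<^sup>+u. ennreal (?n ((u + c * z) / s) * ?n z) * h (u, (c * u + z) / s) \<partial>lborel) \<partial>lborel)"
  proof (rule nn_integral_cong)
    fix z :: real
    have 1: "s * (c * z / s + 1 / s * u) - c * z = u" for u
      using s by (simp add: field_simps)
    have 2: "c * (c * z / s + 1 / s * u) + s * z = (c * u + z) / s" for u
    proof -
      have "c * (c * z + u) + s\<^sup>2 * z = c * u + z" using sc by algebra
      then show ?thesis using s by (simp add: field_simps power2_eq_square)
    qed
    have 3: "c * z / s + u / s = (u + c * z) / s" for u
      using s by (simp add: field_simps)
    show "(\<integral>\<^sup>+x. ennreal (?n x * ?n z) * h (s * x - c * z, c * x + s * z) \<partial>lborel)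
        = ennreal (1/s) * (\<integral>\<^sup>+u. ennreal (?n ((u + c * z) / s) * ?n z) * h (u, (c * u + z) / s) \<partial>lborel)"
      using s by (subst nn_integral_real_affine[where c = "1/s" and t = "c * z / s"])
        (simp_all only: 1 2, auto simp: 3)
  qed
  also have "\<dots> = ennreal (1/s) * (\<integral>\<^sup>+z. \<integral>\<^sup>+u. ennreal (?n u * ?n ((c * u + z) / s)) * h (u, (c * u + z) / s) \<partial>lborel \<partial>lborel)"
    by (subst nn_integral_cmult) (simp_all add: rot)
  also have "\<dots> = ennreal (1/s) * (\<integral>\<^sup>+u. \<integral>\<^sup>+z. ennreal (?n u * ?n ((c * u + z) / s)) * h (u, (c * u + z) / s) \<partial>lborel \<partial>lborel)"
    by (subst lborel_pair.Fubini'[where f = "\<lambda>z u. ennreal (?n u * ?n ((c * u + z) / s)) * h (u, (c * u + z) / s)"]) simp_all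
  also have "\<dots> = ennreal (1/s) * (\<integral>\<^sup>+u. ennreal s * (\<integral>\<^sup>+p. ennreal (?n u * ?n p) * h (u, p) \<partial>lborel) \<partial>lborel)"
  proof -
    have 1: "(c * u + (- c * u + s * p)) / s = p" for u p
      using s by (simp add: field_simps)
    have "(\<integral>\<^sup>+z. ennreal (?n u * ?n ((c * u + z) / s)) * h (u, (c * u + z) / s) \<partial>lborel)
        = ennreal s * (\<integral>\<^sup>+p. ennreal (?n u * ?n p) * h (u, p) \<partial>lborel)" for u
      using s by (subst nn_integral_real_affine[where c = s and t = "- c * u"])
        (simp_all only: 1, auto)
    then show ?thesis by simp
  qed
  also have "\<dots> = (\<integral>\<^sup>+u. \<integral>\<^sup>+p. ennreal (?n u * ?n p) * h (u, p) \<partial>lborel \<partial>lborel)"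
    using s by (subst nn_integral_cmult) (simp_all add: mult.assoc[symmetric] ennreal_mult[symmetric])
  also have "\<dots> = (\<integral>\<^sup>+u. \<integral>\<^sup>+p. h (u, p) \<partial>gauss 1 \<partial>gauss 1)"
    by (simp add: nn_integral_gauss nn_integral_cmult[symmetric] ennreal_mult' mult_ac)
  finally show ?thesis .
qed

lemma gauss_rotation:
  fixes s c :: real
  assumes sc: "s\<^sup>2 + c\<^sup>2 = 1" and s: "s > 0"
  shows "distr (gauss 1 \<Otimes>\<^sub>M gauss 1) (borel \<Otimes>\<^sub>M borel) (\<lambda>(x, z). (s * x - c * z, c * x + s * z))
       = gauss 1 \<Otimes>\<^sub>M gauss 1"
proof (rule measure_eqI)
  interpret G: prob_space "gauss 1" by (simp add: prob_space_gauss)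
  interpret P: pair_sigma_finite "gauss 1" "gauss 1" ..
  let ?d = "distr (gauss 1 \<Otimes>\<^sub>M gauss 1) (borel \<Otimes>\<^sub>M borel) (\<lambda>(x, z). (s * x - c * z, c * x + s * z))"
  show S: "sets ?d = sets (gauss 1 \<Otimes>\<^sub>M gauss 1)"
    by (auto intro!: sets_pair_measure_cong)
  fix A assume "A \<in> sets ?d"
  then have A[measurable]: "A \<in> sets (borel \<Otimes>\<^sub>M borel)" by simp
  have "emeasure ?d A = (\<integral>\<^sup>+w. indicator A w \<partial>?d)"
    by simp
  also have "\<dots> = (\<integral>\<^sup>+w. indicator A (s * fst w - c * snd w, c * fst w + s * snd w) \<partial>(gauss 1 \<Otimes>\<^sub>M gauss 1))"
    by (subst nn_integral_distr) (auto simp: case_prod_beta')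
  also have "\<dots> = (\<integral>\<^sup>+z. \<integral>\<^sup>+x. indicator A (s * x - c * z, c * x + s * z) \<partial>gauss 1 \<partial>gauss 1)"
    by (subst P.nn_integral_snd[symmetric]) auto
  also have "\<dots> = (\<integral>\<^sup>+u. \<integral>\<^sup>+p. indicator A (u, p) \<partial>gauss 1 \<partial>gauss 1)"
    by (rule nn_integral_gauss_rotation[OF sc s]) simp
  also have "\<dots> = (\<integral>\<^sup>+w. indicator A w \<partial>(gauss 1 \<Otimes>\<^sub>M gauss 1))"
    by (subst G.nn_integral_fst) auto
  also have "\<dots> = emeasure (gauss 1 \<Otimes>\<^sub>M gauss 1) A"
    using A S by (subst nn_integral_indicator) auto
  finally show "emeasure ?d A = emeasure (gauss 1 \<Otimes>\<^sub>M gauss 1) A" .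
qed

text \<open>The one-dimensional Cameron-Martin formula: the factor is the ratio of the normal
  densities at \<open>y - a\<close> and \<open>y\<close>. With \<open>a = f x\<close> it becomes the
  channel likelihood.\<close>

lemma gauss_shift:
  assumes s: "s > 0" and [measurable]: "h \<in> borel_measurable borel"
  shows "(\<integral>\<^sup>+n. h (a + n) \<partial>gauss s) = (\<integral>\<^sup>+y. ennreal (exp ((2 * y * a - a\<^sup>2) / (2 * s\<^sup>2))) * h y \<partial>gauss s)"
proof -
  have d: "normal_density 0 s (y - a) = normal_density 0 s y * exp ((2 * y * a - a\<^sup>2) / (2 * s\<^sup>2))" for y
    using s by (simp add: normal_density_def exp_add[symmetric] field_simps power2_eq_square)
  have "(\<integral>\<^sup>+n. h (a + n) \<partial>gauss s) = (\<integral>\<^sup>+n. ennreal (normal_density 0 s n) * h (a + n) \<partial>lborel)"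
    by (rule nn_integral_gauss) simp
  also have "\<dots> = (\<integral>\<^sup>+y. ennreal (normal_density 0 s (y - a)) * h y \<partial>lborel)"
    by (subst nn_integral_real_affine[where c = 1 and t = "- a"]) auto
  also have "\<dots> = (\<integral>\<^sup>+y. ennreal (exp ((2 * y * a - a\<^sup>2) / (2 * s\<^sup>2))) * h y \<partial>gauss s)"
    by (subst nn_integral_gauss) (auto simp: d ennreal_mult' mult_ac)
  finally show ?thesis .
qed

subsection \<open>Conditional expectations from a bounded likelihood\<close>

text \<open>\<open>A\<close> is the prior, \<open>B\<close> a reference law for the observation, and
  \<open>k t z\<close> the likelihood of \<open>z\<close> given \<open>t\<close> relative to
  \<open>B\<close>. Boundedness in \<open>t\<close> makes the posterior integrals exist for every
  \<open>z\<close>, not merely for almost every one.\<close>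

locale bayes_kernel = A: prob_space A + B: prob_space B
  for A :: "'a measure" and B :: "'b measure" +
  fixes k :: "'a \<Rightarrow> 'b \<Rightarrow> real" and U :: "'a \<Rightarrow> real"
  assumes k_meas: "(\<lambda>(t, z). k t z) \<in> borel_measurable (A \<Otimes>\<^sub>M B)"
    and k_pos: "\<And>t z. k t z > 0"
    and k_bdd: "\<And>z. \<exists>c. \<forall>t. k t z \<le> c"
    and k_prob: "\<And>t. t \<in> space A \<Longrightarrow> (\<integral>\<^sup>+z. k t z \<partial>B) = 1"
    and U_meas [measurable]: "U \<in> borel_measurable A"
    and U_sq: "integrable A (\<lambda>t. (U t)\<^sup>2)"
begin

sublocale P: pair_sigma_finite A B ..

text \<open>\<open>q\<close> is the density of the observation relative to \<open>B\<close>,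
  \<open>N z / q z\<close> is the posterior mean of \<open>U\<close>, and \<open>J\<close> is the
  second moment of that posterior mean.\<close>

definition q :: "'b \<Rightarrow> real" where "q z = (\<integral>t. k t z \<partial>A)"
definition N :: "'b \<Rightarrow> real" where "N z = (\<integral>t. U t * k t z \<partial>A)"
definition J :: ennreal where "J = (\<integral>\<^sup>+z. (N z)\<^sup>2 / q z \<partial>B)"

lemma k_measurable [measurable (raw)]:
  assumes [measurable]: "f \<in> M \<rightarrow>\<^sub>M A" "g \<in> M \<rightarrow>\<^sub>M B"
  shows "(\<lambda>x. k (f x) (g x)) \<in> borel_measurable M"
  using measurable_compose[OF measurable_Pair[OF assms] k_meas] by simp

lemma k_nonneg [simp]: "0 \<le> k t z"
  using k_pos[of t z] by simp

lemma U_int: "integrable A U"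
  by (rule A.square_integrable_imp_integrable) (use U_sq in auto)

lemma q_measurable [measurable]: "q \<in> borel_measurable B"
  unfolding q_def by measurable

lemma N_measurable [measurable]: "N \<in> borel_measurable B"
  unfolding N_def by measurable

lemma times_k_int:
  assumes h: "integrable A h" and z: "z \<in> space B"
  shows "integrable A (\<lambda>t. h t * k t z)"
proof -
  from k_bdd[of z] obtain c where c: "\<And>t. k t z \<le> c" by blast
  have [measurable]: "(\<lambda>t. k t z) \<in> borel_measurable A" "h \<in> borel_measurable A"
    using z h by auto
  show ?thesis
  proof (rule Bochner_Integration.integrable_bound[OF integrable_mult_right[OF h, of c]])
    have "\<bar>h t\<bar> * k t z \<le> \<bar>h t\<bar> * \<bar>c\<bar>" for t
      using c[of t] by (intro mult_left_mono) auto
    then show "AE t in A. norm (h t * k t z) \<le> norm (c * h t)"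
      by (simp add: abs_mult mult.commute)
  qed measurable
qed

lemma k_int: "z \<in> space B \<Longrightarrow> integrable A (\<lambda>t. k t z)"
  using times_k_int[of "\<lambda>_. 1" z] by simp

lemma q_pos: assumes z: "z \<in> space B" shows "q z > 0"
proof -
  have "q z \<noteq> 0"
  proof
    assume "q z = 0"
    then have "AE t in A. k t z = 0"
      unfolding q_def by (subst (asm) integral_nonneg_eq_0_iff_AE[OF k_int[OF z]]) auto
    then have "AE t in A. False"
      by (rule AE_mp) (use k_pos[of _ z] in \<open>auto intro!: AE_I2 simp: less_le\<close>)
    then show False by simp
  qed
  moreover have "q z \<ge> 0" unfolding q_def by simp
  ultimately show ?thesis by simp
qed

lemma nn_integral_k: "z \<in> space B \<Longrightarrow> (\<integral>\<^sup>+t. k t z \<partial>A) = ennreal (q z)"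
  unfolding q_def by (rule nn_integral_eq_integral[OF k_int]) auto

lemma k_prob_times:
  assumes [measurable]: "h \<in> borel_measurable A"
  shows "(\<integral>\<^sup>+z. \<integral>\<^sup>+t. h t * ennreal (k t z) \<partial>A \<partial>B) = (\<integral>\<^sup>+t. h t \<partial>A)"
proof -
  have "(\<integral>\<^sup>+z. \<integral>\<^sup>+t. h t * ennreal (k t z) \<partial>A \<partial>B) = (\<integral>\<^sup>+t. \<integral>\<^sup>+z. h t * ennreal (k t z) \<partial>B \<partial>A)"
    by (rule P.Fubini') measurable
  also have "\<dots> = (\<integral>\<^sup>+t. h t \<partial>A)"
    by (intro nn_integral_cong) (simp add: nn_integral_cmult k_prob)
  finally show ?thesis .
qed

text \<open>Pythagoras at a fixed observation: since \<open>N z / q z\<close> is the weighted mean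
  of \<open>U\<close>, the cross term and the square combine to
  \<open>- (N z)\<^sup>2 / q z\<close>.\<close>

lemma variance_split:
  assumes z: "z \<in> space B"
  shows "(\<integral>\<^sup>+t. ennreal ((U t - N z / q z)\<^sup>2) * ennreal (k t z) \<partial>A) + ennreal ((N z)\<^sup>2 / q z)
       = (\<integral>\<^sup>+t. ennreal ((U t)\<^sup>2) * ennreal (k t z) \<partial>A)"
proof -
  note q = q_pos[OF z]
  let ?g = "N z / q z"
  note i = times_k_int[OF U_sq z] times_k_int[OF U_int z] k_int[OF z]
  have e: "(U t - ?g)\<^sup>2 * k t z = (U t)\<^sup>2 * k t z - 2 * ?g * (U t * k t z) + ?g\<^sup>2 * k t z" for t
    by (simp add: power2_eq_square algebra_simps)
  have I: "integrable A (\<lambda>t. (U t - ?g)\<^sup>2 * k t z)"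
    unfolding e using i by auto
  have "(\<integral>t. (U t - ?g)\<^sup>2 * k t z \<partial>A) = (\<integral>t. (U t)\<^sup>2 * k t z \<partial>A) - 2 * ?g * N z + ?g\<^sup>2 * q z"
    unfolding e using i by (simp add: N_def[symmetric] q_def[symmetric])
  also have "\<dots> = (\<integral>t. (U t)\<^sup>2 * k t z \<partial>A) - (N z)\<^sup>2 / q z"
    using q by (simp add: field_simps power2_eq_square)
  finally have E: "(\<integral>t. (U t - ?g)\<^sup>2 * k t z \<partial>A) + (N z)\<^sup>2 / q z = (\<integral>t. (U t)\<^sup>2 * k t z \<partial>A)"
    by simp
  have 1: "(\<integral>\<^sup>+t. ennreal ((U t - ?g)\<^sup>2 * k t z) \<partial>A) = ennreal (\<integral>t. (U t - ?g)\<^sup>2 * k t z \<partial>A)"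
    by (rule nn_integral_eq_integral[OF I]) auto
  have 2: "(\<integral>\<^sup>+t. ennreal ((U t)\<^sup>2 * k t z) \<partial>A) = ennreal (\<integral>t. (U t)\<^sup>2 * k t z \<partial>A)"
    by (rule nn_integral_eq_integral[OF i(1)]) auto
  show ?thesis
    using q by (simp add: ennreal_mult[symmetric] 1 2 E[symmetric] ennreal_plus[symmetric] del: ennreal_plus)
qed

lemma total_variance_split:
  "(\<integral>\<^sup>+z. \<integral>\<^sup>+t. ennreal ((U t - N z / q z)\<^sup>2) * ennreal (k t z) \<partial>A \<partial>B) + J = (\<integral>\<^sup>+t. ennreal ((U t)\<^sup>2) \<partial>A)"
proof -
  have "(\<integral>\<^sup>+z. \<integral>\<^sup>+t. ennreal ((U t - N z / q z)\<^sup>2) * ennreal (k t z) \<partial>A \<partial>B) + J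
     = (\<integral>\<^sup>+z. (\<integral>\<^sup>+t. ennreal ((U t - N z / q z)\<^sup>2) * ennreal (k t z) \<partial>A) + ennreal ((N z)\<^sup>2 / q z) \<partial>B)"
    unfolding J_def by (subst nn_integral_add) auto
  also have "\<dots> = (\<integral>\<^sup>+z. \<integral>\<^sup>+t. ennreal ((U t)\<^sup>2) * ennreal (k t z) \<partial>A \<partial>B)"
    by (rule nn_integral_cong) (rule variance_split)
  also have "\<dots> = (\<integral>\<^sup>+t. ennreal ((U t)\<^sup>2) \<partial>A)"
    by (rule k_prob_times) simp
  finally show ?thesis .
qed

end

section \<open>Random variables whose joint law is given by the likelihood\<close>

locale bayes_model = bayes_kernel A B k U + M: prob_space M
  for A :: "'a measure" and B :: "'b measure" and k U and M :: "'c measure" +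
  fixes T :: "'c \<Rightarrow> 'a" and Z :: "'c \<Rightarrow> 'b"
  assumes T_meas [measurable]: "T \<in> M \<rightarrow>\<^sub>M A" and Z_meas [measurable]: "Z \<in> M \<rightarrow>\<^sub>M B"
    and joint: "\<And>h. h \<in> borel_measurable (A \<Otimes>\<^sub>M B) \<Longrightarrow>
      (\<integral>\<^sup>+\<omega>. h (T \<omega>, Z \<omega>) \<partial>M) = (\<integral>\<^sup>+z. \<integral>\<^sup>+t. h (t, z) * ennreal (k t z) \<partial>A \<partial>B)"
begin

text \<open>\<open>joint\<close> speaks only of nonnegative functions; as an identity of measures it
  also serves signed integrands, which the defining property of a conditional expectation
  requires.\<close>

lemma joint_distr: "distr M (A \<Otimes>\<^sub>M B) (\<lambda>\<omega>. (T \<omega>, Z \<omega>)) = density (A \<Otimes>\<^sub>M B) (\<lambda>(t, z). ennreal (k t z))"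
proof (rule measure_eqI)
  fix C assume "C \<in> sets (distr M (A \<Otimes>\<^sub>M B) (\<lambda>\<omega>. (T \<omega>, Z \<omega>)))"
  then have C[measurable]: "C \<in> sets (A \<Otimes>\<^sub>M B)" by simp
  have "emeasure (distr M (A \<Otimes>\<^sub>M B) (\<lambda>\<omega>. (T \<omega>, Z \<omega>))) C
      = (\<integral>\<^sup>+w. indicator C w \<partial>distr M (A \<Otimes>\<^sub>M B) (\<lambda>\<omega>. (T \<omega>, Z \<omega>)))"
    by simp
  also have "\<dots> = (\<integral>\<^sup>+\<omega>. indicator C (T \<omega>, Z \<omega>) \<partial>M)"
    by (rule nn_integral_distr) auto
  also have "\<dots> = (\<integral>\<^sup>+z. \<integral>\<^sup>+t. indicator C (t, z) * ennreal (k t z) \<partial>A \<partial>B)"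
    by (rule joint) simp
  also have "\<dots> = (\<integral>\<^sup>+w. indicator C w * ennreal (k (fst w) (snd w)) \<partial>(A \<Otimes>\<^sub>M B))"
    by (subst P.nn_integral_snd[symmetric]) auto
  also have "\<dots> = emeasure (density (A \<Otimes>\<^sub>M B) (\<lambda>(t, z). ennreal (k t z))) C"
    by (subst emeasure_density) (auto simp: case_prod_beta' mult.commute)
  finally show "emeasure (distr M (A \<Otimes>\<^sub>M B) (\<lambda>\<omega>. (T \<omega>, Z \<omega>))) C
    = emeasure (density (A \<Otimes>\<^sub>M B) (\<lambda>(t, z). ennreal (k t z))) C" .
qed simp

lemma
  assumes [measurable]: "h \<in> borel_measurable (A \<Otimes>\<^sub>M B)"
    and int: "integrable M (\<lambda>\<omega>. h (T \<omega>, Z \<omega>))"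
  shows joint_integral: "(\<integral>\<omega>. h (T \<omega>, Z \<omega>) \<partial>M) = (\<integral>z. \<integral>t. h (t, z) * k t z \<partial>A \<partial>B)"
proof -
  let ?D = "distr M (A \<Otimes>\<^sub>M B) (\<lambda>\<omega>. (T \<omega>, Z \<omega>))"
  have "integrable ?D h"
    using int by (subst integrable_distr_eq) auto
  then have i: "integrable (A \<Otimes>\<^sub>M B) (\<lambda>w. k (fst w) (snd w) * h w)"
    unfolding joint_distr case_prod_beta' by (subst (asm) integrable_real_density) auto
  have "(\<integral>\<omega>. h (T \<omega>, Z \<omega>) \<partial>M) = (\<integral>w. h w \<partial>?D)"
    by (rule integral_distr[symmetric]) auto
  also have "\<dots> = (\<integral>w. k (fst w) (snd w) * h w \<partial>(A \<Otimes>\<^sub>M B))"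
    unfolding joint_distr case_prod_beta' by (subst integral_real_density) auto
  also have "\<dots> = (\<integral>z. \<integral>t. h (t, z) * k t z \<partial>A \<partial>B)"
    using P.integral_snd[of "\<lambda>t z. k t z * h (t, z)"] i by (simp add: case_prod_beta' mult.commute)
  finally show ?thesis .
qed

lemma U_T_int: "integrable M (\<lambda>\<omega>. U (T \<omega>))"
proof (rule integrableI_bounded)
  have "(\<integral>\<^sup>+\<omega>. ennreal (norm (U (T \<omega>))) \<partial>M) = (\<integral>\<^sup>+t. ennreal (norm (U t)) \<partial>A)"
    using joint[of "\<lambda>w. ennreal (norm (U (fst w)))"] by (simp add: k_prob_times)
  also have "\<dots> < \<infinity>" using U_int by (simp add: integrable_iff_bounded)
  finally show "(\<integral>\<^sup>+\<omega>. ennreal (norm (U (T \<omega>))) \<partial>M) < \<infinity>" .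
qed simp

text \<open>Integrating out the parameter cancels \<open>q\<close> and leaves the integral of the
  absolute value of \<open>N\<close>, which is at most the first absolute moment of
  \<open>U\<close>.\<close>

lemma posterior_mean_int: "integrable M (\<lambda>\<omega>. N (Z \<omega>) / q (Z \<omega>))"
proof (rule integrableI_bounded)
  have "(\<integral>\<^sup>+\<omega>. ennreal (norm (N (Z \<omega>) / q (Z \<omega>))) \<partial>M)
      = (\<integral>\<^sup>+z. \<integral>\<^sup>+t. ennreal (norm (N z / q z)) * ennreal (k t z) \<partial>A \<partial>B)"
    using joint[of "\<lambda>w. ennreal (norm (N (snd w) / q (snd w)))"] by simp
  also have "\<dots> = (\<integral>\<^sup>+z. ennreal (norm (N z)) \<partial>B)"
  proof (rule nn_integral_cong)
    fix z assume z: "z \<in> space B"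
    have [measurable]: "(\<lambda>t. k t z) \<in> borel_measurable A" using z by auto
    show "(\<integral>\<^sup>+t. ennreal (norm (N z / q z)) * ennreal (k t z) \<partial>A) = ennreal (norm (N z))"
      using q_pos[OF z] by (subst nn_integral_cmult) (auto simp: nn_integral_k[OF z] ennreal_mult[symmetric])
  qed
  also have "\<dots> \<le> (\<integral>\<^sup>+z. \<integral>\<^sup>+t. ennreal (norm (U t)) * ennreal (k t z) \<partial>A \<partial>B)"
  proof (rule nn_integral_mono)
    fix z assume z: "z \<in> space B"
    show "ennreal (norm (N z)) \<le> (\<integral>\<^sup>+t. ennreal (norm (U t)) * ennreal (k t z) \<partial>A)"
      using integral_norm_bound_ennreal[OF times_k_int[OF U_int z]]
      by (simp add: N_def abs_mult ennreal_mult)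
  qed
  also have "\<dots> = (\<integral>\<^sup>+t. ennreal (norm (U t)) \<partial>A)"
    by (rule k_prob_times) simp
  also have "\<dots> < \<infinity>" using U_int by (simp add: integrable_iff_bounded)
  finally show "(\<integral>\<^sup>+\<omega>. ennreal (norm (N (Z \<omega>) / q (Z \<omega>))) \<partial>M) < \<infinity>" .
qed simp

text \<open>\<open>B'\<close> is separate from \<open>B\<close> because the conditioning algebra in
  the definitions is generated by a plain Borel algebra, whereas \<open>B\<close> carries a
  probability law; only their common sets matter.\<close>

lemma subalgebra_gen_alg:
  assumes "sets B = sets B'"
  shows "subalgebra M (gen_alg M Z B')"
  unfolding subalgebra_def gen_alg_def
proof safe
  fix C assume "C \<in> sets (vimage_algebra (space M) Z B')"
  then have "C \<in> sets (vimage_algebra (space M) Z B)"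
    by (simp add: sets_vimage_algebra_cong[OF assms])
  then show "C \<in> sets M"
    using measurable_sets[OF Z_meas] Z_meas[THEN measurable_space] by (auto simp: sets_vimage_algebra2)
qed auto

lemma finite_measure_subalgebra_gen_alg:
  "sets B = sets B' \<Longrightarrow> finite_measure_subalgebra M (gen_alg M Z B')"
  by (intro finite_measure_subalgebra.intro finite_measure_subalgebra_axioms.intro
      M.finite_measure_axioms subalgebra_gen_alg)

lemma measurable_gen_alg:
  assumes B': "sets B = sets B'" and h: "h \<in> borel_measurable B"
  shows "(\<lambda>\<omega>. h (Z \<omega>)) \<in> borel_measurable (gen_alg M Z B')"
proof -
  have "Z \<in> gen_alg M Z B' \<rightarrow>\<^sub>M B"
    unfolding gen_alg_def measurable_cong_sets[OF refl B']
    using Z_meas[THEN measurable_space] sets_eq_imp_space_eq[OF B'] by (intro measurable_vimage_algebra1) auto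
  then show ?thesis using h by (rule measurable_compose)
qed

text \<open>Bayes' formula. An event of the observation algebra is the preimage of some
  \<open>D\<close>; over it both \<open>U\<close> and the candidate integrate to the integral of
  \<open>N\<close> over \<open>D\<close> under \<open>B\<close>.\<close>

theorem posterior_mean:
  assumes B': "sets B = sets B'"
  shows "AE \<omega> in M. real_cond_exp M (gen_alg M Z B') (\<lambda>\<omega>. U (T \<omega>)) \<omega> = N (Z \<omega>) / q (Z \<omega>)"
proof -
  interpret F: finite_measure_subalgebra M "gen_alg M Z B'"
    by (rule finite_measure_subalgebra_gen_alg[OF B'])
  show ?thesis
  proof (rule F.real_cond_exp_charact)
    fix C assume "C \<in> sets (gen_alg M Z B')"
    then have "C \<in> sets (vimage_algebra (space M) Z B)"
      by (simp add: gen_alg_def sets_vimage_algebra_cong[OF B'])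
    then obtain D where D[measurable]: "D \<in> sets B" and C: "C = Z -` D \<inter> space M"
      using Z_meas[THEN measurable_space] by (auto simp: sets_vimage_algebra2)
    have CM: "C \<in> sets M" unfolding C by measurable
    have ind: "indicator C \<omega> = (indicator D (Z \<omega>) :: real)" if "\<omega> \<in> space M" for \<omega>
      using that by (auto simp: C indicator_def)
    let ?h1 = "\<lambda>w. indicator D (snd w) * U (fst w) :: real"
    let ?h2 = "\<lambda>w. indicator D (snd w) * (N (snd w) / q (snd w)) :: real"
    have "(\<integral>\<omega>\<in>C. U (T \<omega>) \<partial>M) = (\<integral>\<omega>. ?h1 (T \<omega>, Z \<omega>) \<partial>M)"
      unfolding set_lebesgue_integral_def by (rule Bochner_Integration.integral_cong) (auto simp: ind)
    also have "\<dots> = (\<integral>z. \<integral>t. ?h1 (t, z) * k t z \<partial>A \<partial>B)"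
    proof (rule joint_integral)
      show "integrable M (\<lambda>\<omega>. ?h1 (T \<omega>, Z \<omega>))"
        using integrable_mult_indicator[OF CM U_T_int]
        by (rule Bochner_Integration.integrable_cong[THEN iffD1, rotated -1]) (auto simp: ind)
    qed measurable
    also have "\<dots> = (\<integral>z. indicator D z * N z \<partial>B)"
      unfolding N_def by (simp add: mult.assoc)
    also have "\<dots> = (\<integral>z. \<integral>t. ?h2 (t, z) * k t z \<partial>A \<partial>B)"
      by (rule Bochner_Integration.integral_cong) (use q_pos in \<open>auto simp: q_def[symmetric] less_le\<close>)
    also have "\<dots> = (\<integral>\<omega>. ?h2 (T \<omega>, Z \<omega>) \<partial>M)"
    proof (rule joint_integral[symmetric])
      show "integrable M (\<lambda>\<omega>. ?h2 (T \<omega>, Z \<omega>))"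
        using integrable_mult_indicator[OF CM posterior_mean_int]
        by (rule Bochner_Integration.integrable_cong[THEN iffD1, rotated -1]) (auto simp: ind)
    qed measurable
    also have "\<dots> = (\<integral>\<omega>\<in>C. N (Z \<omega>) / q (Z \<omega>) \<partial>M)"
      unfolding set_lebesgue_integral_def by (rule Bochner_Integration.integral_cong) (auto simp: ind)
    finally show "(\<integral>\<omega>\<in>C. U (T \<omega>) \<partial>M) = (\<integral>\<omega>\<in>C. N (Z \<omega>) / q (Z \<omega>) \<partial>M)" .
  qed (auto intro!: U_T_int posterior_mean_int measurable_gen_alg[OF B', of "\<lambda>z. N z / q z"])
qed

text \<open>The joint law turns the mean-squared error into the averaged variance of
  \<open>total_variance_split\<close>; the finite second moment of \<open>U\<close> then lets a
  Bochner integral, as used in the definitions, replace the nonnegative one.\<close>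

lemma mmse_plus_J:
  "ennreal (\<integral>\<omega>. (U (T \<omega>) - N (Z \<omega>) / q (Z \<omega>))\<^sup>2 \<partial>M) + J = (\<integral>\<^sup>+t. ennreal ((U t)\<^sup>2) \<partial>A)"
proof -
  let ?X = "\<lambda>\<omega>. (U (T \<omega>) - N (Z \<omega>) / q (Z \<omega>))\<^sup>2"
  have "(\<integral>\<^sup>+\<omega>. ennreal (?X \<omega>) \<partial>M)
      = (\<integral>\<^sup>+z. \<integral>\<^sup>+t. ennreal ((U t - N z / q z)\<^sup>2) * ennreal (k t z) \<partial>A \<partial>B)"
    using joint[of "\<lambda>w. ennreal ((U (fst w) - N (snd w) / q (snd w))\<^sup>2)"] by simp
  then have e: "(\<integral>\<^sup>+\<omega>. ennreal (?X \<omega>) \<partial>M) + J = (\<integral>\<^sup>+t. ennreal ((U t)\<^sup>2) \<partial>A)"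
    using total_variance_split by simp
  have "(\<integral>\<^sup>+\<omega>. ennreal (?X \<omega>) \<partial>M) \<le> (\<integral>\<^sup>+\<omega>. ennreal (?X \<omega>) \<partial>M) + J"
    by simp
  also have "\<dots> < \<infinity>"
    unfolding e using U_sq by (simp add: integrable_iff_bounded)
  finally have "(\<integral>\<^sup>+\<omega>. ennreal (?X \<omega>) \<partial>M) < \<infinity>" .
  then have "integrable M ?X" by (intro integrableI_bounded) auto
  then have "(\<integral>\<^sup>+\<omega>. ennreal (?X \<omega>) \<partial>M) = ennreal (\<integral>\<omega>. ?X \<omega> \<partial>M)"
    by (rule nn_integral_eq_integral) auto
  with e show ?thesis by simp
qed

end

subsection \<open>Entropy along the Gaussian channel\<close>

lemma pair_prob_space_gauss: "pair_prob_space (gauss 1) (gauss 1)"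
  by (simp add: pair_prob_space_def pair_sigma_finite_def prob_space_gauss prob_space_imp_sigma_finite)

lemma measurable_gauss_pair [simp]: "borel_measurable (gauss s \<Otimes>\<^sub>M gauss t) = borel_measurable (borel \<Otimes>\<^sub>M borel)"
  by (rule measurable_cong_sets) (auto intro!: sets_pair_measure_cong)

lemma integral_gauss_rotation:
  fixes s c :: real and F :: "real \<times> real \<Rightarrow> real"
  assumes sc: "s\<^sup>2 + c\<^sup>2 = 1" and s: "s > 0" and [measurable]: "F \<in> borel_measurable (borel \<Otimes>\<^sub>M borel)"
  shows "(\<integral>w. F (s * fst w - c * snd w, c * fst w + s * snd w) \<partial>(gauss 1 \<Otimes>\<^sub>M gauss 1))
       = (\<integral>w. F w \<partial>(gauss 1 \<Otimes>\<^sub>M gauss 1))"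
  by (subst (2) gauss_rotation[OF sc s, symmetric], subst integral_distr) (auto simp: case_prod_beta')

text \<open>The rotation with coefficients \<open>a / r\<close> and \<open>- b / r\<close> makes
  \<open>a * p + b * u\<close> equal to \<open>r\<close> times a single standard coordinate; the
  other coordinate integrates out.\<close>

lemma gauss_sum:
  fixes a b :: real
  assumes a: "a > 0" and r: "r > 0" "r\<^sup>2 = a\<^sup>2 + b\<^sup>2" and [measurable]: "h \<in> borel_measurable borel"
  shows "(\<integral>\<^sup>+p. \<integral>\<^sup>+u. h (p + b * u) \<partial>gauss 1 \<partial>gauss a) = (\<integral>\<^sup>+x. h x \<partial>gauss r)"
proof -
  interpret G: prob_space "gauss 1" by (simp add: prob_space_gauss)
  interpret P: pair_sigma_finite "gauss 1" "gauss 1" ..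
  have "(a / r)\<^sup>2 + (- b / r)\<^sup>2 = 1"
    using r by (simp add: power_divide add_divide_distrib[symmetric] flip: r(2))
  then have rot: "(\<integral>\<^sup>+z. \<integral>\<^sup>+x. h (r * (a / r * x - (- b / r) * z)) \<partial>gauss 1 \<partial>gauss 1)
     = (\<integral>\<^sup>+u. \<integral>\<^sup>+p. h (r * u) \<partial>gauss 1 \<partial>gauss 1)"
    using nn_integral_gauss_rotation[of "a / r" "- b / r" "\<lambda>w. h (r * fst w)"] a r by simp
  have "(\<integral>\<^sup>+p. \<integral>\<^sup>+u. h (p + b * u) \<partial>gauss 1 \<partial>gauss a) = (\<integral>\<^sup>+p. \<integral>\<^sup>+u. h (a * p + b * u) \<partial>gauss 1 \<partial>gauss 1)"
    by (subst gauss_scale[OF a], subst nn_integral_distr) auto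
  also have "\<dots> = (\<integral>\<^sup>+u. \<integral>\<^sup>+p. h (a * p + b * u) \<partial>gauss 1 \<partial>gauss 1)"
    using P.Fubini'[of "\<lambda>u p. h (a * p + b * u)"] by simp
  also have "\<dots> = (\<integral>\<^sup>+u. \<integral>\<^sup>+p. h (r * u) \<partial>gauss 1 \<partial>gauss 1)"
  proof -
    have "r * (a / r * x - (- b / r) * z) = a * x + b * z" for x z
      using r(1) by (simp add: field_simps)
    with rot show ?thesis by simp
  qed
  also have "\<dots> = (\<integral>\<^sup>+u. h (r * u) \<partial>gauss 1)"
    using G.emeasure_space_1 by simp
  also have "\<dots> = (\<integral>\<^sup>+x. h x \<partial>gauss r)"
    by (subst gauss_scale[OF r(1)], subst nn_integral_distr) auto
  finally show ?thesis .
qed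

lemma integrable_gauss_iff:
  fixes h :: "real \<Rightarrow> real"
  assumes "h \<in> borel_measurable borel"
  shows "integrable (gauss s) h \<longleftrightarrow> integrable lborel (\<lambda>x. normal_density 0 s x * h x)"
  unfolding gauss_def using assms by (subst integrable_density) auto

lemma integral_gauss:
  fixes h :: "real \<Rightarrow> real"
  assumes "h \<in> borel_measurable borel"
  shows "(\<integral>x. h x \<partial>gauss s) = (\<integral>x. normal_density 0 s x * h x \<partial>lborel)"
  unfolding gauss_def using assms by (subst integral_density) auto

lemma gauss_square_integrable: "s > 0 \<Longrightarrow> integrable (gauss s) (\<lambda>x. x\<^sup>2)"
  using integrable_normal_moment[of s 0 2] by (simp add: integrable_gauss_iff)

lemma gauss_integrable_ident: "s > 0 \<Longrightarrow> integrable (gauss s) (\<lambda>x. x)"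
  using integrable_normal_moment[of s 0 1] by (simp add: integrable_gauss_iff)

lemma integral_gauss_1_ident: "(\<integral>x. x \<partial>gauss 1) = 0"
  using integral_std_normal_moment_odd[of 0] by (simp add: integral_gauss)

lemma nn_integral_gauss_1_square: "(\<integral>\<^sup>+x. ennreal (x\<^sup>2) \<partial>gauss 1) = 1"
proof -
  have "(\<integral>x. x\<^sup>2 \<partial>gauss 1) = 1"
    using integral_std_normal_moment_even[of 1] by (simp add: integral_gauss)
  then show ?thesis
    using nn_integral_eq_integral[OF gauss_square_integrable[of 1]] by simp
qed

lemma gauss_exp_martingale:
  shows "integrable (gauss 1) (\<lambda>w. exp (l * w - l\<^sup>2 / 2))" "(\<integral>w. exp (l * w - l\<^sup>2 / 2) \<partial>gauss 1) = 1"
proof -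
  interpret G: prob_space "gauss 1" by (simp add: prob_space_gauss)
  have "(\<integral>\<^sup>+w. ennreal (exp (l * w - l\<^sup>2 / 2)) \<partial>gauss 1) = 1"
    using gauss_shift[of 1 "\<lambda>_. 1" l] G.emeasure_space_1 by (simp add: diff_divide_distrib mult.commute)
  then show "integrable (gauss 1) (\<lambda>w. exp (l * w - l\<^sup>2 / 2))" "(\<integral>w. exp (l * w - l\<^sup>2 / 2) \<partial>gauss 1) = 1"
    using integrableI_nn_integral_finite[of "\<lambda>w. exp (l * w - l\<^sup>2 / 2)" "gauss 1" 1]
      integral_eq_nn_integral[of "\<lambda>w. exp (l * w - l\<^sup>2 / 2)" "gauss 1"] by auto
qed

text \<open>The term \<open>- t + 1\<close> makes the integrand nonnegative for
  \<open>t > 0\<close>, so that entropies can be taken in \<open>ennreal\<close>; for a probability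
  density relative to a probability measure it integrates to zero.\<close>

definition ent :: "real \<Rightarrow> real" where "ent t = t * ln t - t + 1"

lemma ent_measurable [measurable]: "ent \<in> borel_measurable borel"
  unfolding ent_def by measurable

text \<open>Young's inequality: \<open>exp a - 1\<close> is the convex conjugate of
  \<open>ent\<close>, with equality at \<open>a = ln t\<close>.\<close>

lemma ent_dual:
  assumes "t > 0" shows "t * a - exp a + 1 \<le> ent t"
proof -
  have "1 + (a - ln t) \<le> exp (a - ln t)" by (rule exp_ge_add_one_self)
  also have "\<dots> = exp a / t" using assms by (simp add: exp_diff)
  finally have "t * (1 + (a - ln t)) \<le> exp a" using assms by (simp add: field_simps)
  then show ?thesis by (simp add: ent_def algebra_simps)
qed

lemma ent_nonneg: "t > 0 \<Longrightarrow> ent t \<ge> 0"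
  using ent_dual[of t 0] by simp

text \<open>Jensen's inequality with a remainder. \<open>ent_dual\<close> is applied pointwise with
  the logarithm of \<open>m * exp (l * w - l\<^sup>2 / 2)\<close>, the Gaussian tilt having the mass
  and first moment of \<open>k\<close>; integration yields the extra term
  \<open>n\<^sup>2 / (2 * m)\<close>.\<close>

lemma entropy_gain:
  fixes k :: "real \<Rightarrow> real"
  assumes [measurable]: "k \<in> borel_measurable borel" and pos: "\<And>w. k w > 0" and bdd: "\<And>w. k w \<le> c"
    and m: "m = (\<integral>w. k w \<partial>gauss 1)" and m_pos: "m > 0" and n: "n = (\<integral>w. w * k w \<partial>gauss 1)"
  shows "ennreal (ent m + n\<^sup>2 / (2 * m)) \<le> (\<integral>\<^sup>+w. ennreal (ent (k w)) \<partial>gauss 1)"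
proof -
  interpret G: prob_space "gauss 1" by (simp add: prob_space_gauss)
  \<comment> \<open>This slope maximises the gain \<open>l * n - l\<^sup>2 * m / 2\<close>.\<close>
  define l where "l = n / m"
  define r where "r w = k w * (l * w - l\<^sup>2 / 2 + ln m) - m * exp (l * w - l\<^sup>2 / 2) + 1" for w
  have ik: "integrable (gauss 1) k"
    by (rule G.integrable_const_bound[of _ c]) (use bdd pos in \<open>auto simp: abs_of_pos\<close>)
  have iwk: "integrable (gauss 1) (\<lambda>w. w * k w)"
  proof (rule Bochner_Integration.integrable_bound)
    show "integrable (gauss 1) (\<lambda>w. c * w)"
      by (intro integrable_mult_right gauss_integrable_ident) simp
    have "\<bar>w\<bar> * \<bar>k w\<bar> \<le> \<bar>w\<bar> * \<bar>c\<bar>" for w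
      using pos[of w] bdd[of w] by (intro mult_left_mono) auto
    then show "AE w in gauss 1. norm (w * k w) \<le> norm (c * w)" by (simp add: abs_mult mult.commute)
  qed auto
  have r_eq: "r w = l * (w * k w) + (ln m - l\<^sup>2 / 2) * k w - m * exp (l * w - l\<^sup>2 / 2) + 1" for w
    by (simp add: r_def algebra_simps)
  have ir: "integrable (gauss 1) r"
    unfolding r_eq[abs_def] using ik iwk gauss_exp_martingale(1)[of l] by (intro Bochner_Integration.integrable_add
      Bochner_Integration.integrable_diff integrable_mult_right) auto
  have "(\<integral>w. r w \<partial>gauss 1) = l * n + (ln m - l\<^sup>2 / 2) * m - m + 1"
    unfolding r_eq using ik iwk gauss_exp_martingale[of l] G.prob_space by (simp add: m n)
  also have "\<dots> = ent m + n\<^sup>2 / (2 * m)"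
    using m_pos by (simp add: ent_def l_def field_simps power2_eq_square)
  finally have "ent m + n\<^sup>2 / (2 * m) = (\<integral>w. r w \<partial>gauss 1)" by simp
  \<comment> \<open>\<open>r\<close> may be negative while \<open>ent (k w)\<close> is not, so the
    positive part keeps the pointwise bound and permits a nonnegative integral.\<close>
  also have "\<dots> \<le> (\<integral>w. max 0 (r w) \<partial>gauss 1)"
    by (rule integral_mono) (use ir in auto)
  finally have "ennreal (ent m + n\<^sup>2 / (2 * m)) \<le> ennreal (\<integral>w. max 0 (r w) \<partial>gauss 1)"
    by (rule ennreal_leI)
  also have "\<dots> = (\<integral>\<^sup>+w. ennreal (max 0 (r w)) \<partial>gauss 1)"
    by (rule nn_integral_eq_integral[symmetric]) (use ir in auto)
  also have "\<dots> \<le> (\<integral>\<^sup>+w. ennreal (ent (k w)) \<partial>gauss 1)"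
  proof (rule nn_integral_mono, rule ennreal_leI)
    fix w
    have "m * exp (l * w - l\<^sup>2 / 2) = exp (l * w - l\<^sup>2 / 2 + ln m)"
      using m_pos by (simp add: exp_add)
    then have "r w \<le> ent (k w)"
      using ent_dual[OF pos[of w], of "l * w - l\<^sup>2 / 2 + ln m"] by (simp add: r_def)
    then show "max 0 (r w) \<le> ent (k w)" using ent_nonneg[OF pos[of w]] by simp
  qed
  finally show ?thesis .
qed

section \<open>The nonlinear Gaussian channel and its smoothed likelihoods\<close>

locale gauss_channel =
  fixes \<sigma> :: real and f :: "real \<Rightarrow> real"
  assumes sigma_pos: "\<sigma> > 0" and f_meas [measurable]: "f \<in> borel_measurable borel"
    and f_int: "integrable (gauss 1) (\<lambda>x. (f x)\<^sup>2)"
begin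

text \<open>The likelihood of \<open>y\<close> given \<open>x\<close>, relative to the law of the noise instead of Lebesgue
  measure: this makes the likelihood bounded in \<open>x\<close> for every \<open>y\<close>.\<close>

definition K :: "real \<Rightarrow> real \<Rightarrow> real" where
  "K x y = exp ((2 * y * f x - (f x)\<^sup>2) / (2 * \<sigma>\<^sup>2))"

text \<open>Given \<open>phat = b\<close>, the input \<open>x\<close> is normal with mean
  \<open>b\<close> and variance \<open>v\<close>, so this is the conditional density of
  \<open>y\<close> relative to the noise law.\<close>

definition Q :: "real \<Rightarrow> real \<Rightarrow> real \<Rightarrow> real" where
  "Q v b y = (\<integral>u. K (b + sqrt v * u) y \<partial>gauss 1)"

text \<open>By Gaussian integration by parts, for \<open>v > 0\<close> this is \<open>sqrt v\<close>
  times the derivative of \<open>Q v b y\<close> in \<open>b\<close>; hence \<open>Fisher v\<close>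
  is \<open>v\<close> times an averaged Fisher information.\<close>

definition R :: "real \<Rightarrow> real \<Rightarrow> real \<Rightarrow> real" where
  "R v b y = (\<integral>u. u * K (b + sqrt v * u) y \<partial>gauss 1)"

text \<open>Relative entropy of the law of \<open>y\<close> given \<open>phat\<close> from the noise
  law, averaged over \<open>phat\<close>. It is the mutual information of \<open>y\<close> and
  \<open>phat\<close> plus the relative entropy of \<open>y\<close> from the noise, which is
  independent of \<open>v\<close>.\<close>

definition H :: "real \<Rightarrow> ennreal" where
  "H v = (\<integral>\<^sup>+b. \<integral>\<^sup>+y. ennreal (ent (Q v b y)) \<partial>gauss \<sigma> \<partial>gauss (sqrt (1 - v)))"

definition Fisher :: "real \<Rightarrow> ennreal" where
  "Fisher v = (\<integral>\<^sup>+b. \<integral>\<^sup>+y. ennreal ((R v b y)\<^sup>2 / Q v b y) \<partial>gauss \<sigma> \<partial>gauss (sqrt (1 - v)))"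

lemma K_measurable [measurable (raw)]:
  assumes [measurable]: "g \<in> borel_measurable M" "h \<in> borel_measurable M"
  shows "(\<lambda>x. K (g x) (h x)) \<in> borel_measurable M"
  unfolding K_def by measurable

lemma K_pos: "K x y > 0" by (simp add: K_def)

lemma K_le: "K x y \<le> exp (y\<^sup>2 / (2 * \<sigma>\<^sup>2))"
proof -
  have "2 * y * f x - (f x)\<^sup>2 \<le> y\<^sup>2"
    using zero_le_power2[of "y - f x"] by (simp add: power2_diff)
  then show ?thesis unfolding K_def using sigma_pos by (simp add: divide_right_mono)
qed

lemma Q_measurable [measurable (raw)]:
  assumes [measurable]: "g \<in> borel_measurable M" "h \<in> borel_measurable M"
  shows "(\<lambda>x. Q v (g x) (h x)) \<in> borel_measurable M"
proof -
  interpret G: prob_space "gauss 1" by (simp add: prob_space_gauss)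
  show ?thesis unfolding Q_def by measurable
qed

lemma R_measurable [measurable (raw)]:
  assumes [measurable]: "g \<in> borel_measurable M" "h \<in> borel_measurable M"
  shows "(\<lambda>x. R v (g x) (h x)) \<in> borel_measurable M"
proof -
  interpret G: prob_space "gauss 1" by (simp add: prob_space_gauss)
  show ?thesis unfolding R_def by measurable
qed

lemma K_integrable:
  assumes M: "finite_measure M" and [measurable]: "g \<in> borel_measurable M"
  shows "integrable M (\<lambda>x. K (g x) y)"
  by (rule finite_measure.integrable_const_bound[OF M, of _ "exp (y\<^sup>2 / (2 * \<sigma>\<^sup>2))"])
     (use K_le K_pos in \<open>auto simp: abs_of_pos\<close>)

lemma times_K_integrable:
  assumes h: "integrable M h" and [measurable]: "g \<in> borel_measurable M"
  shows "integrable M (\<lambda>x. h x * K (g x) y)"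
proof (rule Bochner_Integration.integrable_bound[OF integrable_mult_right[OF h, of "exp (y\<^sup>2 / (2 * \<sigma>\<^sup>2))"]])
  have "\<bar>h x\<bar> * \<bar>K (g x) y\<bar> \<le> \<bar>h x\<bar> * exp (y\<^sup>2 / (2 * \<sigma>\<^sup>2))" for x
    using K_pos[of "g x" y] K_le[of "g x" y] by (intro mult_left_mono) auto
  then show "AE x in M. norm (h x * K (g x) y) \<le> norm (exp (y\<^sup>2 / (2 * \<sigma>\<^sup>2)) * h x)"
    by (simp add: abs_mult mult.commute)
  show "(\<lambda>x. h x * K (g x) y) \<in> borel_measurable M" using h by measurable
qed

lemma Q_pos: "Q v b y > 0"
proof -
  interpret G: prob_space "gauss 1" by (simp add: prob_space_gauss)
  have i: "integrable (gauss 1) (\<lambda>u. K (b + sqrt v * u) y)"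
    by (rule K_integrable) (auto intro: G.finite_measure_axioms)
  have "Q v b y \<noteq> 0"
  proof
    assume "Q v b y = 0"
    then have "AE u in gauss 1. K (b + sqrt v * u) y = 0"
      unfolding Q_def by (subst (asm) integral_nonneg_eq_0_iff_AE[OF i]) (auto intro: less_imp_le[OF K_pos])
    then have "AE u in gauss 1. False" by (rule AE_mp) (auto intro!: AE_I2 simp: K_def)
    then show False by simp
  qed
  moreover have "Q v b y \<ge> 0"
    unfolding Q_def by (rule integral_nonneg_AE) (auto intro: less_imp_le[OF K_pos])
  ultimately show ?thesis by simp
qed

lemma Q_le: "Q v b y \<le> exp (y\<^sup>2 / (2 * \<sigma>\<^sup>2))"
proof -
  interpret G: prob_space "gauss 1" by (simp add: prob_space_gauss)
  show ?thesis unfolding Q_def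
    by (rule G.integral_le_const) (auto intro!: K_integrable K_le G.finite_measure_axioms)
qed

lemma Q_0: "Q 0 b y = K b y"
proof -
  interpret G: prob_space "gauss 1" by (simp add: prob_space_gauss)
  show ?thesis using G.prob_space by (simp add: Q_def)
qed

section \<open>Passing from conditional variance \<open>v\<close> to a smaller
  \<open>v'\<close>\<close>

context
  fixes v v' :: real
  assumes v': "0 \<le> v'" and vv: "v' < v"
begin

text \<open>Gaussian increments of variance \<open>v - v'\<close> and \<open>v'\<close> add up to
  one of variance \<open>v\<close>: in rotated coordinates \<open>K\<close> sees only
  \<open>fst w\<close>. The test function \<open>G\<close> covers both the total mass (constant 1)
  and the first moment (\<open>fst\<close>).\<close>

lemma rotation_semigroup:
  fixes G :: "real \<times> real \<Rightarrow> real"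
  assumes G: "integrable (gauss 1 \<Otimes>\<^sub>M gauss 1) (\<lambda>w. G w * K (b + sqrt (v - v') * fst w + sqrt v' * snd w) y)"
    and [measurable]: "G \<in> borel_measurable (borel \<Otimes>\<^sub>M borel)"
  shows "(\<integral>w. \<integral>u. G (w, u) * K (b + sqrt (v - v') * w + sqrt v' * u) y \<partial>gauss 1 \<partial>gauss 1)
      = (\<integral>w. G (sqrt ((v - v') / v) * fst w - sqrt (v' / v) * snd w, sqrt (v' / v) * fst w + sqrt ((v - v') / v) * snd w)
            * K (b + sqrt v * fst w) y \<partial>(gauss 1 \<Otimes>\<^sub>M gauss 1))"
proof -
  interpret P: pair_prob_space "gauss 1" "gauss 1" by (rule pair_prob_space_gauss)
  let ?s = "sqrt ((v - v') / v)" and ?c = "sqrt (v' / v)"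
  have sc: "?s\<^sup>2 + ?c\<^sup>2 = 1" and s: "?s > 0"
    using v' vv by (simp_all add: add_divide_distrib[symmetric])
  \<comment> \<open>The coefficient of \<open>p\<close> collects to \<open>sqrt v\<close>, and that
    of \<open>r\<close> cancels.\<close>
  have e: "sqrt (v - v') * (?s * p - ?c * r) + sqrt v' * (?c * p + ?s * r) = sqrt v * p" for p r
  proof -
    have "sqrt (v - v') * (?s * p - ?c * r) + sqrt v' * (?c * p + ?s * r)
        = (sqrt (v - v') * ?s + sqrt v' * ?c) * p + (sqrt v' * ?s - sqrt (v - v') * ?c) * r"
      by (simp only: algebra_simps)
    also have "sqrt (v - v') * ?s + sqrt v' * ?c = (v - v') / sqrt v + v' / sqrt v"
      using v' vv by (simp add: real_sqrt_divide)
    also have "\<dots> = sqrt v"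
      using v' vv by (simp add: add_divide_distrib[symmetric] real_div_sqrt)
    also have "sqrt v' * ?s - sqrt (v - v') * ?c = 0"
      by (simp add: real_sqrt_divide)
    finally show ?thesis by simp
  qed
  have "(\<integral>w. \<integral>u. G (w, u) * K (b + sqrt (v - v') * w + sqrt v' * u) y \<partial>gauss 1 \<partial>gauss 1)
      = (\<integral>w. G w * K (b + sqrt (v - v') * fst w + sqrt v' * snd w) y \<partial>(gauss 1 \<Otimes>\<^sub>M gauss 1))"
    using P.integral_fst'[OF G] by simp
  also have "\<dots> = (\<integral>w. G (?s * fst w - ?c * snd w, ?c * fst w + ?s * snd w)
      * K (b + (sqrt (v - v') * (?s * fst w - ?c * snd w) + sqrt v' * (?c * fst w + ?s * snd w))) y \<partial>(gauss 1 \<Otimes>\<^sub>M gauss 1))"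
    using integral_gauss_rotation[OF sc s, of "\<lambda>w. G w * K (b + sqrt (v - v') * fst w + sqrt v' * snd w) y"]
    by (simp add: add.assoc)
  finally show ?thesis unfolding e .
qed

lemma Q_semigroup: "(\<integral>w. Q v' (b + sqrt (v - v') * w) y \<partial>gauss 1) = Q v b y"
proof -
  interpret P: pair_prob_space "gauss 1" "gauss 1" by (rule pair_prob_space_gauss)
  have [simp]: "finite_measure (gauss 1 \<Otimes>\<^sub>M gauss 1)" by (rule P.finite_measure_axioms)
  have i: "integrable (gauss 1 \<Otimes>\<^sub>M gauss 1) (\<lambda>w. K (g w) y)"
    if [measurable]: "g \<in> borel_measurable (borel \<Otimes>\<^sub>M borel)" for g
    by (rule K_integrable) auto
  show ?thesis
    using rotation_semigroup[of "\<lambda>_. 1" b y] i P.integral_fst'[OF i[of "\<lambda>w. b + sqrt v * fst w"]]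
      P.M1.prob_space
    by (simp add: Q_def)
qed

text \<open>The increment \<open>w\<close> is a multiple of the coordinate seen by \<open>K\<close>
  minus a multiple of an independent centred one; the latter contributes nothing.\<close>

lemma R_semigroup: "(\<integral>w. w * Q v' (b + sqrt (v - v') * w) y \<partial>gauss 1) = sqrt ((v - v') / v) * R v b y"
proof -
  interpret P: pair_prob_space "gauss 1" "gauss 1" by (rule pair_prob_space_gauss)
  have i1: "integrable (gauss 1 \<Otimes>\<^sub>M gauss 1) (\<lambda>w. fst w)"
    using P.M1.prob_space gauss_integrable_ident[of 1] by (intro P.Fubini_integrable) auto
  have i2: "integrable (gauss 1 \<Otimes>\<^sub>M gauss 1) (\<lambda>w. snd w)"
    using P.M1.prob_space gauss_integrable_ident[of 1] by (intro P.Fubini_integrable) auto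
  have j: "integrable (gauss 1 \<Otimes>\<^sub>M gauss 1) (\<lambda>w. fst w * K (g w) y)"
    "integrable (gauss 1 \<Otimes>\<^sub>M gauss 1) (\<lambda>w. snd w * K (g w) y)"
    if "g \<in> borel_measurable (borel \<Otimes>\<^sub>M borel)" for g
    using times_K_integrable[OF i1, of g] times_K_integrable[OF i2, of g] that by simp_all
  let ?s = "sqrt ((v - v') / v)" and ?c = "sqrt (v' / v)"
  let ?K = "\<lambda>w. K (b + sqrt v * fst w) y"
  have "(\<integral>w. w * Q v' (b + sqrt (v - v') * w) y \<partial>gauss 1)
      = (\<integral>w. \<integral>u. w * K (b + sqrt (v - v') * w + sqrt v' * u) y \<partial>gauss 1 \<partial>gauss 1)"
    by (simp add: Q_def)
  also have "\<dots> = (\<integral>w. (?s * fst w - ?c * snd w) * ?K w \<partial>(gauss 1 \<Otimes>\<^sub>M gauss 1))"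
    using rotation_semigroup[of fst b y] j(1) by simp
  also have "\<dots> = (\<integral>w. ?s * (fst w * ?K w) - ?c * (snd w * ?K w) \<partial>(gauss 1 \<Otimes>\<^sub>M gauss 1))"
    by (simp add: algebra_simps)
  also have "\<dots> = ?s * (\<integral>w. fst w * ?K w \<partial>(gauss 1 \<Otimes>\<^sub>M gauss 1)) - ?c * (\<integral>w. snd w * ?K w \<partial>(gauss 1 \<Otimes>\<^sub>M gauss 1))"
    using j[of "\<lambda>w. b + sqrt v * fst w"] by (subst Bochner_Integration.integral_diff) auto
  also have "(\<integral>w. fst w * ?K w \<partial>(gauss 1 \<Otimes>\<^sub>M gauss 1)) = R v b y"
    using P.integral_fst'[OF j(1)[of "\<lambda>w. b + sqrt v * fst w"]] P.M1.prob_space by (simp add: R_def)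
  also have "(\<integral>w. snd w * ?K w \<partial>(gauss 1 \<Otimes>\<^sub>M gauss 1)) = 0"
    using P.integral_fst'[OF j(2)[of "\<lambda>w. b + sqrt v * fst w"]] integral_gauss_1_ident by simp
  finally show ?thesis by simp
qed

text \<open>This is \<open>entropy_gain\<close> for the density as a function of the increment of
  \<open>phat\<close>; the two semigroup identities supply its mass and its first moment.\<close>

lemma ent_Q_gain:
  "(\<integral>\<^sup>+w. ennreal (ent (Q v' (b + sqrt (v - v') * w) y)) \<partial>gauss 1)
    \<ge> ennreal (ent (Q v b y)) + ennreal ((v - v') / (2 * v)) * ennreal ((R v b y)\<^sup>2 / Q v b y)"
proof -
  have q: "Q v b y > 0" by (rule Q_pos)
  have "ennreal (ent (Q v b y) + (sqrt ((v - v') / v) * R v b y)\<^sup>2 / (2 * Q v b y))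
      \<le> (\<integral>\<^sup>+w. ennreal (ent (Q v' (b + sqrt (v - v') * w) y)) \<partial>gauss 1)"
    by (rule entropy_gain[OF _ Q_pos Q_le]) (simp_all add: Q_semigroup R_semigroup q)
  moreover have "(sqrt ((v - v') / v) * R v b y)\<^sup>2 / (2 * Q v b y) = (v - v') / (2 * v) * ((R v b y)\<^sup>2 / Q v b y)"
    using v' vv q by (simp add: power_mult_distrib)
  moreover have "(v - v') / (2 * v) \<ge> 0" "(R v b y)\<^sup>2 / Q v b y \<ge> 0"
    using v' vv q by auto
  ultimately show ?thesis
    using ent_nonneg[OF q] by (simp only: ennreal_mult[symmetric] ennreal_plus[symmetric] mult_nonneg_nonneg)
qed

text \<open>The pointwise gain is averaged. \<open>phat\<close> at level \<open>v\<close> plus an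
  independent increment of variance \<open>v - v'\<close> has variance \<open>1 - v'\<close>, so
  \<open>gauss_sum\<close> identifies the result as \<open>H v'\<close>.\<close>

lemma H_gain:
  assumes v1: "v < 1"
  shows "H v + ennreal ((v - v') / (2 * v)) * Fisher v \<le> H v'"
proof -
  interpret G: prob_space "gauss 1" by (simp add: prob_space_gauss)
  interpret Y: prob_space "gauss \<sigma>" by (simp add: prob_space_gauss sigma_pos)
  interpret P: pair_sigma_finite "gauss 1" "gauss \<sigma>" ..
  have "H v + ennreal ((v - v') / (2 * v)) * Fisher v
      = (\<integral>\<^sup>+b. \<integral>\<^sup>+y. ennreal (ent (Q v b y)) + ennreal ((v - v') / (2 * v)) * ennreal ((R v b y)\<^sup>2 / Q v b y)
           \<partial>gauss \<sigma> \<partial>gauss (sqrt (1 - v)))"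
    unfolding H_def Fisher_def by (simp add: nn_integral_add nn_integral_cmult)
  also have "\<dots> \<le> (\<integral>\<^sup>+b. \<integral>\<^sup>+y. \<integral>\<^sup>+w. ennreal (ent (Q v' (b + sqrt (v - v') * w) y)) \<partial>gauss 1
           \<partial>gauss \<sigma> \<partial>gauss (sqrt (1 - v)))"
    by (intro nn_integral_mono ent_Q_gain)
  also have "\<dots> = (\<integral>\<^sup>+b. \<integral>\<^sup>+w. \<integral>\<^sup>+y. ennreal (ent (Q v' (b + sqrt (v - v') * w) y)) \<partial>gauss \<sigma>
           \<partial>gauss 1 \<partial>gauss (sqrt (1 - v)))"
    by (intro nn_integral_cong P.Fubini') measurable
  also have "\<dots> = H v'"
    unfolding H_def using v' vv v1 by (intro gauss_sum) auto
  finally show ?thesis .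
qed

end

text \<open>At \<open>v = 0\<close> the density is \<open>K\<close> itself, whose logarithm is at
  most \<open>y\<^sup>2 / (2 * \<sigma>\<^sup>2)\<close>. What remains is the second moment of
  \<open>f x + n\<close>, finite since \<open>f\<close> is square integrable.\<close>

lemma H_0_finite: "H 0 < \<infinity>"
proof -
  interpret G: prob_space "gauss 1" by (simp add: prob_space_gauss)
  interpret Y: prob_space "gauss \<sigma>" by (simp add: prob_space_gauss sigma_pos)
  have s2: "\<sigma>\<^sup>2 > 0" using sigma_pos by simp
  have ent_K: "ennreal (ent (K b y)) \<le> 1 + ennreal (K b y) * ennreal (y\<^sup>2 / (2 * \<sigma>\<^sup>2))" for b y
  proof -
    have "ln (K b y) \<le> ln (exp (y\<^sup>2 / (2 * \<sigma>\<^sup>2)))"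
      using K_pos K_le by (subst ln_le_cancel_iff) auto
    then have "K b y * ln (K b y) \<le> K b y * (y\<^sup>2 / (2 * \<sigma>\<^sup>2))"
      using K_pos[of b y] by (intro mult_left_mono) auto
    then have "ent (K b y) \<le> 1 + K b y * (y\<^sup>2 / (2 * \<sigma>\<^sup>2))"
      using K_pos[of b y] unfolding ent_def by linarith
    then have "ennreal (ent (K b y)) \<le> ennreal (1 + K b y * (y\<^sup>2 / (2 * \<sigma>\<^sup>2)))"
      by (rule ennreal_leI)
    also have "\<dots> = 1 + ennreal (K b y) * ennreal (y\<^sup>2 / (2 * \<sigma>\<^sup>2))"
      using K_pos[of b y] by (simp add: ennreal_mult[symmetric] less_imp_le)
    finally show ?thesis .
  qed
  have sq: "ennreal ((f b + n)\<^sup>2 / (2 * \<sigma>\<^sup>2)) \<le> ennreal ((f b)\<^sup>2 / \<sigma>\<^sup>2) + ennreal (n\<^sup>2 / \<sigma>\<^sup>2)" for b n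
  proof -
    have "(f b + n)\<^sup>2 / (2 * \<sigma>\<^sup>2) \<le> (f b)\<^sup>2 / \<sigma>\<^sup>2 + n\<^sup>2 / \<sigma>\<^sup>2"
    proof -
      have "(f b + n)\<^sup>2 \<le> 2 * ((f b)\<^sup>2 + n\<^sup>2)"
        using zero_le_power2[of "f b - n"] by (simp add: power2_sum power2_diff)
      then have "(f b + n)\<^sup>2 / (2 * \<sigma>\<^sup>2) \<le> 2 * ((f b)\<^sup>2 + n\<^sup>2) / (2 * \<sigma>\<^sup>2)"
        by (rule divide_right_mono) simp
      then show ?thesis by (simp add: add_divide_distrib)
    qed
    then show ?thesis by (simp add: ennreal_plus[symmetric] del: ennreal_plus)
  qed
  have "H 0 = (\<integral>\<^sup>+b. \<integral>\<^sup>+y. ennreal (ent (K b y)) \<partial>gauss \<sigma> \<partial>gauss 1)"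
    by (simp add: H_def Q_0)
  also have "\<dots> \<le> (\<integral>\<^sup>+b. \<integral>\<^sup>+y. 1 + ennreal (K b y) * ennreal (y\<^sup>2 / (2 * \<sigma>\<^sup>2)) \<partial>gauss \<sigma> \<partial>gauss 1)"
    by (intro nn_integral_mono ent_K)
  \<comment> \<open>Weighting the noise law by \<open>K b y\<close> recentres it at
    \<open>f b\<close>.\<close>
  also have "\<dots> = (\<integral>\<^sup>+b. 1 + (\<integral>\<^sup>+n. ennreal ((f b + n)\<^sup>2 / (2 * \<sigma>\<^sup>2)) \<partial>gauss \<sigma>) \<partial>gauss 1)"
    using gauss_shift[OF sigma_pos, of "\<lambda>y. ennreal (y\<^sup>2 / (2 * \<sigma>\<^sup>2))"] sigma_pos
    by (intro nn_integral_cong) (simp add: K_def nn_integral_add)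
  also have "\<dots> \<le> (\<integral>\<^sup>+b. 1 + (\<integral>\<^sup>+n. ennreal ((f b)\<^sup>2 / \<sigma>\<^sup>2) + ennreal (n\<^sup>2 / \<sigma>\<^sup>2) \<partial>gauss \<sigma>) \<partial>gauss 1)"
    by (intro nn_integral_mono add_mono sq order_refl)
  also have "\<dots> = 1 + ((\<integral>\<^sup>+b. ennreal ((f b)\<^sup>2 / \<sigma>\<^sup>2) \<partial>gauss 1) + (\<integral>\<^sup>+n. ennreal (n\<^sup>2 / \<sigma>\<^sup>2) \<partial>gauss \<sigma>))"
    using sigma_pos by (simp add: nn_integral_add)
  also have "\<dots> < \<infinity>"
    using integrable_divide[OF f_int, of "\<sigma>\<^sup>2"] integrable_divide[OF gauss_square_integrable[OF sigma_pos], of "\<sigma>\<^sup>2"]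
    by (auto simp: integrable_iff_bounded)
  finally show ?thesis .
qed

subsection \<open>The transfer curve as a Fisher information\<close>

context
  fixes v :: real
  assumes v0: "0 < v" and v1: "v < 1"
begin

text \<open>The reference law, under which \<open>y\<close> is pure noise independent of
  \<open>phat\<close>; the true dependence sits in the likelihood.\<close>

definition obs_law :: "(real \<times> real) measure" where
  "obs_law = gauss (sqrt (1 - v)) \<Otimes>\<^sub>M gauss \<sigma>"

definition lik :: "real \<Rightarrow> real \<times> real \<Rightarrow> real" where
  "lik u z = K (fst z + sqrt v * u) (snd z)"

text \<open>The normalised estimation error \<open>(x - phat) / sqrt v\<close>, written as one coordinate
  of a rotation of \<open>(x, z)\<close> whose other coordinate is \<open>phat / sqrt (1 - v)\<close>.\<close>

definition err :: "real \<times> real \<times> real \<Rightarrow> real" where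
  "err \<omega> = sqrt v * fst \<omega> - sqrt (1 - v) * fst (snd \<omega>)"

lemma sets_obs_law: "sets obs_law = sets (borel :: (real \<times> real) measure)"
  unfolding obs_law_def borel_prod[symmetric] by (rule sets_pair_measure_cong) simp_all

lemma prob_space_obs_law: "prob_space obs_law"
proof -
  interpret B: prob_space "gauss (sqrt (1 - v))" using v1 by (simp add: prob_space_gauss)
  interpret Y: prob_space "gauss \<sigma>" by (simp add: prob_space_gauss sigma_pos)
  interpret pair_prob_space "gauss (sqrt (1 - v))" "gauss \<sigma>" ..
  show ?thesis unfolding obs_law_def by (rule prob_space_axioms)
qed

lemma nn_integral_obs_law:
  assumes "h \<in> borel_measurable (borel \<Otimes>\<^sub>M borel)"
  shows "(\<integral>\<^sup>+z. h z \<partial>obs_law) = (\<integral>\<^sup>+b. \<integral>\<^sup>+y. h (b, y) \<partial>gauss \<sigma> \<partial>gauss (sqrt (1 - v)))"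
proof -
  interpret Y: prob_space "gauss \<sigma>" by (simp add: prob_space_gauss sigma_pos)
  show ?thesis unfolding obs_law_def using assms by (subst Y.nn_integral_fst) auto
qed

lemma nn_integral_K: "(\<integral>\<^sup>+y. ennreal (K x y) * h y \<partial>gauss \<sigma>) = (\<integral>\<^sup>+n. h (f x + n) \<partial>gauss \<sigma>)"
  if "h \<in> borel_measurable borel"
  using gauss_shift[OF sigma_pos that, of "f x"] by (simp add: K_def)

lemma obs_bayes_kernel: "bayes_kernel (gauss 1) obs_law lik (\<lambda>u. u)"
proof -
  interpret G: prob_space "gauss 1" by (simp add: prob_space_gauss)
  interpret O: prob_space obs_law by (rule prob_space_obs_law)
  note [measurable_cong] = sets_obs_law
  show ?thesis
  proof unfold_locales
    have [measurable]: "fst \<in> borel_measurable obs_law" "snd \<in> borel_measurable obs_law"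
      unfolding obs_law_def by measurable
    show "(\<lambda>(t, z). lik t z) \<in> borel_measurable (gauss 1 \<Otimes>\<^sub>M obs_law)"
      unfolding lik_def case_prod_beta' by measurable
    show "lik t z > 0" for t z unfolding lik_def by (rule K_pos)
    show "\<exists>c. \<forall>t. lik t z \<le> c" for z unfolding lik_def using K_le by blast
    show "(\<integral>\<^sup>+z. ennreal (lik t z) \<partial>obs_law) = 1" for t
      using nn_integral_K[of "\<lambda>_. 1"] sigma_pos v1 by (subst nn_integral_obs_law) (simp_all add: lik_def)
    show "integrable (gauss 1) (\<lambda>t. t\<^sup>2)" by (rule gauss_square_integrable) simp
  qed simp
qed

lemma prob_space_chan_space: "prob_space (chan_space \<sigma>)"
proof -
  interpret G: prob_space "gauss 1" by (simp add: prob_space_gauss)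
  interpret Y: prob_space "gauss \<sigma>" by (simp add: prob_space_gauss sigma_pos)
  interpret P: pair_prob_space "gauss 1" "gauss \<sigma>" ..
  interpret PP: pair_prob_space "gauss 1" "gauss 1 \<Otimes>\<^sub>M gauss \<sigma>" ..
  show ?thesis unfolding chan_space_def by (rule PP.prob_space_axioms)
qed

text \<open>\<open>err\<close> and \<open>phat / sqrt (1 - v)\<close> are a rotation of
  \<open>(x, z)\<close>, hence independent standard normals, and
  \<open>x = phat + sqrt v * err\<close>. Shifting the noise by \<open>f x\<close> turns into the
  weight \<open>K\<close>.\<close>

lemma obs_joint_law:
  assumes h: "h \<in> borel_measurable (gauss 1 \<Otimes>\<^sub>M obs_law)"
  shows "(\<integral>\<^sup>+\<omega>. h (err \<omega>, rv_phat v \<omega>, rv_y f \<omega>) \<partial>chan_space \<sigma>)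
      = (\<integral>\<^sup>+z. \<integral>\<^sup>+u. h (u, z) * ennreal (lik u z) \<partial>gauss 1 \<partial>obs_law)"
proof -
  interpret G: prob_space "gauss 1" by (simp add: prob_space_gauss)
  interpret Y: prob_space "gauss \<sigma>" by (simp add: prob_space_gauss sigma_pos)
  interpret P: pair_prob_space "gauss 1" "gauss \<sigma>" ..
  interpret PP: pair_prob_space "gauss 1" "gauss 1 \<Otimes>\<^sub>M gauss \<sigma>" ..
  interpret GG: pair_prob_space "gauss 1" "gauss 1" ..
  let ?s = "sqrt v" and ?c = "sqrt (1 - v)"
  have "sets (gauss 1 \<Otimes>\<^sub>M obs_law) = sets (borel \<Otimes>\<^sub>M (borel \<Otimes>\<^sub>M borel))"
    unfolding obs_law_def by (intro sets_pair_measure_cong) simp_all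
  then have h': "h \<in> borel_measurable (borel \<Otimes>\<^sub>M (borel \<Otimes>\<^sub>M borel))"
    using h measurable_cong_sets by blast
  have [measurable]: "(\<lambda>x. h (g x, i x)) \<in> borel_measurable M"
    if [measurable]: "g \<in> borel_measurable M" "i \<in> M \<rightarrow>\<^sub>M borel \<Otimes>\<^sub>M borel"
    for M :: "'a measure" and g i
    by (rule measurable_compose[OF _ h']) measurable
  have [measurable]: "fst \<in> borel_measurable obs_law" "snd \<in> borel_measurable obs_law"
    unfolding obs_law_def by measurable
  have sc: "?s\<^sup>2 + ?c\<^sup>2 = 1" and s: "?s > 0" and c: "?c > 0"
    using v0 v1 by simp_all
  have phat: "(1 - v) * x + sqrt (v * (1 - v)) * z = ?c * (?c * x + ?s * z)" for x z
  proof -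
    have "1 - v = ?c * ?c" using v1 by simp
    then have "(1 - v) * x + sqrt (v * (1 - v)) * z = ?c * ?c * x + ?s * ?c * z"
      by (simp only: real_sqrt_mult)
    then show ?thesis by (simp only: algebra_simps)
  qed
  have x_eq: "?c * (?c * x + ?s * z) + ?s * (?s * x - ?c * z) = x" for x z
  proof -
    have "?c * (?c * x + ?s * z) + ?s * (?s * x - ?c * z) = (?s\<^sup>2 + ?c\<^sup>2) * x"
      by (simp only: power2_eq_square algebra_simps)
    then show ?thesis using sc by simp
  qed
  \<comment> \<open>With the noise integrated out first, only a function of the rotated pair
    remains, to which rotation invariance applies.\<close>
  define W where "W w = (\<integral>\<^sup>+y. ennreal (K (?c * snd w + ?s * fst w) y) * h (fst w, ?c * snd w, y) \<partial>gauss \<sigma>)"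
    for w :: "real \<times> real"
  have [measurable]: "W \<in> borel_measurable (borel \<Otimes>\<^sub>M borel)"
    unfolding W_def by measurable
  have "(\<integral>\<^sup>+\<omega>. h (err \<omega>, rv_phat v \<omega>, rv_y f \<omega>) \<partial>chan_space \<sigma>)
      = (\<integral>\<^sup>+x. \<integral>\<^sup>+z. \<integral>\<^sup>+n. h (?s * x - ?c * z, ?c * (?c * x + ?s * z), f x + n) \<partial>gauss \<sigma> \<partial>gauss 1 \<partial>gauss 1)"
    unfolding chan_space_def err_def rv_phat_def rv_y_def phat
  proof -
    have "(\<integral>\<^sup>+w. h (?s * x - ?c * fst w, ?c * (?c * x + ?s * fst w), f x + snd w) \<partial>(gauss 1 \<Otimes>\<^sub>M gauss \<sigma>))
       = (\<integral>\<^sup>+z. \<integral>\<^sup>+n. h (?s * x - ?c * z, ?c * (?c * x + ?s * z), f x + n) \<partial>gauss \<sigma> \<partial>gauss 1)" for x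
      by (subst Y.nn_integral_fst[symmetric]) simp_all
    then show "(\<integral>\<^sup>+\<omega>. h (?s * fst \<omega> - ?c * fst (snd \<omega>), ?c * (?c * fst \<omega> + ?s * fst (snd \<omega>)), f (fst \<omega>) + snd (snd \<omega>))
          \<partial>(gauss 1 \<Otimes>\<^sub>M (gauss 1 \<Otimes>\<^sub>M gauss \<sigma>)))
       = (\<integral>\<^sup>+x. \<integral>\<^sup>+z. \<integral>\<^sup>+n. h (?s * x - ?c * z, ?c * (?c * x + ?s * z), f x + n) \<partial>gauss \<sigma> \<partial>gauss 1 \<partial>gauss 1)"
      by (simp add: P.nn_integral_fst[symmetric])
  qed
  also have "\<dots> = (\<integral>\<^sup>+x. \<integral>\<^sup>+z. W (?s * x - ?c * z, ?c * x + ?s * z) \<partial>gauss 1 \<partial>gauss 1)"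
    unfolding W_def by (simp add: x_eq nn_integral_K)
  also have "\<dots> = (\<integral>\<^sup>+z. \<integral>\<^sup>+x. W (?s * x - ?c * z, ?c * x + ?s * z) \<partial>gauss 1 \<partial>gauss 1)"
    by (rule GG.Fubini'[of "\<lambda>z x. W (?s * x - ?c * z, ?c * x + ?s * z)"]) measurable
  also have "\<dots> = (\<integral>\<^sup>+u. \<integral>\<^sup>+p. W (u, p) \<partial>gauss 1 \<partial>gauss 1)"
    by (rule nn_integral_gauss_rotation[OF sc s]) measurable
  also have "\<dots> = (\<integral>\<^sup>+u. \<integral>\<^sup>+b. \<integral>\<^sup>+y. ennreal (K (b + ?s * u) y) * h (u, b, y) \<partial>gauss \<sigma> \<partial>gauss ?c \<partial>gauss 1)"
    unfolding W_def by (subst gauss_scale[OF c], subst nn_integral_distr) auto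
  also have "\<dots> = (\<integral>\<^sup>+u. \<integral>\<^sup>+z. h (u, z) * ennreal (lik u z) \<partial>obs_law \<partial>gauss 1)"
    by (subst nn_integral_obs_law) (auto simp: lik_def mult.commute)
  also have "\<dots> = (\<integral>\<^sup>+z. \<integral>\<^sup>+u. h (u, z) * ennreal (lik u z) \<partial>gauss 1 \<partial>obs_law)"
  proof -
    interpret O: prob_space obs_law by (rule prob_space_obs_law)
    interpret GO: pair_sigma_finite "gauss 1" obs_law ..
    have "(\<lambda>(t, z). ennreal (lik t z)) \<in> borel_measurable (gauss 1 \<Otimes>\<^sub>M obs_law)"
      unfolding lik_def case_prod_beta' by measurable
    then show ?thesis
      using h by (intro GO.Fubini'[symmetric]) (simp add: case_prod_beta')
  qed
  finally show ?thesis .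
qed

lemma obs_bayes_model:
  "bayes_model (gauss 1) obs_law lik (\<lambda>u. u) (chan_space \<sigma>) err (\<lambda>\<omega>. (rv_phat v \<omega>, rv_y f \<omega>))"
proof (intro bayes_model.intro bayes_model_axioms.intro obs_bayes_kernel prob_space_chan_space obs_joint_law)
  show "err \<in> chan_space \<sigma> \<rightarrow>\<^sub>M gauss 1"
    unfolding err_def chan_space_def by measurable
  show "(\<lambda>\<omega>. (rv_phat v \<omega>, rv_y f \<omega>)) \<in> chan_space \<sigma> \<rightarrow>\<^sub>M obs_law"
    unfolding rv_phat_def rv_y_def chan_space_def obs_law_def by measurable
qed

text \<open>\<open>phat\<close> is observed, so only \<open>sqrt v * err\<close> is estimated and
  \<open>mmse_xpy\<close> is \<open>v\<close> times the error for \<open>err\<close>. Since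
  \<open>err\<close> has unit variance, \<open>v * phi\<close> is the second moment \<open>J\<close>
  of its posterior mean, which unfolds to the Fisher integral.\<close>

lemma phi_Fisher:
  shows "ennreal (v * phi \<sigma> f 1 v) = Fisher v"
proof -
  interpret bayes_model "gauss 1" obs_law lik "\<lambda>u. u" "chan_space \<sigma>" err "\<lambda>\<omega>. (rv_phat v \<omega>, rv_y f \<omega>)"
    by (rule obs_bayes_model)
  let ?M = "chan_space \<sigma>"
  let ?Z = "\<lambda>\<omega>. (rv_phat v \<omega>, rv_y f \<omega>)"
  let ?F = "gen_alg ?M ?Z (borel :: (real \<times> real) measure)"
  interpret F: finite_measure_subalgebra ?M ?F
    by (rule finite_measure_subalgebra_gen_alg[OF sets_obs_law])
  have err_int: "integrable ?M err" using U_T_int .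
  have x_int: "integrable ?M rv_x"
  proof -
    interpret P: prob_space "gauss 1 \<Otimes>\<^sub>M gauss \<sigma>"
      by (intro prob_space_pair prob_space_gauss sigma_pos) simp
    have "integrable (distr ?M (gauss 1) fst) (\<lambda>x. x)"
      unfolding chan_space_def P.distr_pair_fst by (rule gauss_integrable_ident) simp
    then show ?thesis
      by (subst (asm) integrable_distr_eq) (auto simp: chan_space_def rv_x_def[abs_def])
  qed
  have x_eq: "rv_x \<omega> = rv_phat v \<omega> + sqrt v * err \<omega>" for \<omega>
  proof -
    have "rv_phat v \<omega> + sqrt v * err \<omega> = (1 - v + sqrt v * sqrt v) * fst \<omega>"
      unfolding rv_phat_def err_def real_sqrt_mult by (simp only: algebra_simps)
    then show ?thesis using v0 by (simp add: rv_x_def)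
  qed
  have phat_int: "integrable ?M (rv_phat v)"
    using Bochner_Integration.integrable_diff[OF x_int integrable_mult_right[OF err_int, of "sqrt v"]] by (simp add: x_eq)
  have "fst \<in> borel_measurable obs_law"
    unfolding obs_law_def by measurable
  from measurable_gen_alg[OF sets_obs_law this] have phat_F: "rv_phat v \<in> borel_measurable ?F"
    by (simp only: fst_conv)
  have "AE \<omega> in ?M. real_cond_exp ?M ?F rv_x \<omega> = rv_phat v \<omega> + sqrt v * (N (?Z \<omega>) / q (?Z \<omega>))"
  proof -
    have "AE \<omega> in ?M. real_cond_exp ?M ?F (\<lambda>\<omega>. rv_phat v \<omega> + sqrt v * err \<omega>) \<omega>
        = real_cond_exp ?M ?F (rv_phat v) \<omega> + real_cond_exp ?M ?F (\<lambda>\<omega>. sqrt v * err \<omega>) \<omega>"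
      using phat_int err_int by (intro F.real_cond_exp_add) auto
    moreover have "AE \<omega> in ?M. real_cond_exp ?M ?F (rv_phat v) \<omega> = rv_phat v \<omega>"
      by (rule F.real_cond_exp_F_meas[OF phat_int phat_F])
    moreover have "AE \<omega> in ?M. real_cond_exp ?M ?F (\<lambda>\<omega>. sqrt v * err \<omega>) \<omega> = sqrt v * real_cond_exp ?M ?F err \<omega>"
      by (rule F.real_cond_exp_cmult[OF err_int])
    moreover have "AE \<omega> in ?M. real_cond_exp ?M ?F err \<omega> = N (?Z \<omega>) / q (?Z \<omega>)"
      using posterior_mean[OF sets_obs_law] by simp
    ultimately show ?thesis
      unfolding x_eq[abs_def] by eventually_elim simp
  qed
  then have ae: "AE \<omega> in ?M. (rv_x \<omega> - real_cond_exp ?M ?F rv_x \<omega>)\<^sup>2 = v * (err \<omega> - N (?Z \<omega>) / q (?Z \<omega>))\<^sup>2"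
  proof eventually_elim
    case (elim \<omega>)
    have "rv_x \<omega> - real_cond_exp ?M ?F rv_x \<omega> = sqrt v * (err \<omega> - N (?Z \<omega>) / q (?Z \<omega>))"
      unfolding elim by (simp add: x_eq algebra_simps)
    then show ?case using v0 by (simp add: power_mult_distrib)
  qed
  define m where "m = (\<integral>\<omega>. (err \<omega> - N (?Z \<omega>) / q (?Z \<omega>))\<^sup>2 \<partial>?M)"
  have "mmse_xpy \<sigma> f v = (\<integral>\<omega>. v * (err \<omega> - N (?Z \<omega>) / q (?Z \<omega>))\<^sup>2 \<partial>?M)"
    unfolding mmse_xpy_def Let_def
    by (intro integral_cong_AE[OF _ _ ae] borel_measurable_power borel_measurable_diff borel_measurable_times
        borel_measurable_const borel_measurable_integrable[OF x_int] borel_measurable_cond_exp2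
        borel_measurable_integrable[OF err_int] borel_measurable_integrable[OF posterior_mean_int])
  then have phi: "v * phi \<sigma> f 1 v = 1 - m"
    using v0 by (simp add: phi_def m_def)
  have m0: "m \<ge> 0" unfolding m_def by simp
  have J: "ennreal m + J = 1"
    using mmse_plus_J nn_integral_gauss_1_square by (simp add: m_def)
  \<comment> \<open>Finiteness of \<open>J\<close> allows passing from \<open>ennreal\<close> to an
    equation of reals that can be solved for it.\<close>
  have "J \<noteq> \<infinity>" using J by (auto simp: top_add)
  then obtain j where j: "j \<ge> 0" "J = ennreal j" by (cases J) auto
  with J m0 have "m + j = 1" by (simp add: ennreal_plus[symmetric] del: ennreal_plus)
  then have "ennreal (v * phi \<sigma> f 1 v) = J"
    unfolding phi j(2) by (intro arg_cong[where f = ennreal]) simp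
  also have "J = Fisher v"
    unfolding J_def Fisher_def
    by (subst nn_integral_obs_law) (simp_all add: N_def q_def R_def Q_def lik_def)
  finally show ?thesis .
qed

end

text \<open>Halving \<open>v\<close> raises \<open>H\<close> by at least a quarter of
  \<open>v * phi\<close>, so the partial sums telescope to at most four times \<open>H 0\<close>.
  The points start at \<open>1/2\<close> because \<open>H_gain\<close> requires
  \<open>v < 1\<close>.\<close>

lemma phi_dyadic_summable:
  assumes pos: "\<And>v. v \<in> {0<..1} \<Longrightarrow> phi \<sigma> f 1 v > 0"
  shows "summable (\<lambda>i. (1 / 2) ^ Suc i * phi \<sigma> f 1 ((1 / 2) ^ Suc i))"
proof -
  define v :: "nat \<Rightarrow> real" where "v i = (1 / 2) ^ Suc i" for i
  define c where "c i = v i * phi \<sigma> f 1 (v i)" for i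
  have v: "0 < v i" "v i < 1" for i
  proof -
    show "0 < v i" by (simp add: v_def)
    have "v i \<le> (1 / 2) ^ 1" unfolding v_def by (rule power_decreasing) auto
    then show "v i < 1" by simp
  qed
  have c0: "c i \<ge> 0" for i
    using pos[of "v i"] v[of i] by (simp add: c_def)
  have step: "H (v i) + ennreal (c i / 4) \<le> H (v (Suc i))" for i
  proof -
    have "(v i - v (Suc i)) / (2 * v i) = 1 / 4" by (simp add: v_def)
    moreover have "ennreal (1 / 4) * ennreal (c i) = ennreal (c i / 4)"
      using c0 by (simp add: ennreal_mult[symmetric])
    moreover have "v (Suc i) < v i" using v(1)[of i] by (simp add: v_def)
    ultimately show ?thesis
      using H_gain[of "v (Suc i)" "v i"] v[of i] v[of "Suc i"] by (simp add: phi_Fisher[symmetric] c_def)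
  qed
  have "ennreal (\<Sum>i<n. c i / 4) \<le> H (v n)" for n
  proof (induction n)
    case (Suc n)
    have "ennreal (\<Sum>i<Suc n. c i / 4) = ennreal (\<Sum>i<n. c i / 4) + ennreal (c n / 4)"
      using c0 by (simp add: sum_nonneg)
    also have "\<dots> \<le> H (v (Suc n))"
      using Suc step[of n] by (meson add_right_mono order_trans)
    finally show ?case .
  qed simp
  also have "H (v n) \<le> H 0" for n
    using H_gain[of 0 "v n"] v[of n] by (auto intro: order_trans[rotated])
  finally have "ennreal (\<Sum>i<n. c i / 4) \<le> H 0" for n .
  then have "(\<Sum>i<n. c i / 4) \<le> enn2real (H 0)" for n
    using H_0_finite by (cases "H 0") (auto simp: ennreal_le_iff)
  then have "summable (\<lambda>i. c i / 4)"
    using c0 by (intro summableI_nonneg_bounded) auto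
  then show ?thesis
    using summable_mult[of "\<lambda>i. c i / 4" 4] by (simp add: c_def v_def)
qed

end

subsection \<open>The extended inverse\<close>

lemma ext_inv_bdd [simp]: "bdd_above ({0} \<union> {v \<in> {0<..1::real}. g v > \<rho>})"
  by (rule bdd_aboveI[of _ 1]) auto

lemma ext_inv_nonneg: "0 \<le> ext_inv g \<rho>"
  unfolding ext_inv_def by (rule cSup_upper) (auto simp: ext_inv_bdd[simplified])

lemma ext_inv_le_1: "ext_inv g \<rho> \<le> 1"
  unfolding ext_inv_def by (rule cSup_least) auto

lemma ext_inv_antimono: "\<rho> \<le> \<rho>' \<Longrightarrow> ext_inv g \<rho>' \<le> ext_inv g \<rho>"
  unfolding ext_inv_def by (rule cSup_subset_mono[OF _ ext_inv_bdd]) auto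

lemma ext_inv_measurable [measurable]: "ext_inv g \<in> borel_measurable borel"
proof -
  have "mono (\<lambda>\<rho>. - ext_inv g \<rho>)"
    by (auto intro!: monoI ext_inv_antimono)
  then have "(\<lambda>\<rho>. - (- ext_inv g \<rho>)) \<in> borel_measurable borel"
    by (intro borel_measurable_uminus borel_measurable_mono)
  then show ?thesis by simp
qed

text \<open>Together with \<open>phi_scale\<close> this reduces every positive \<delta> to the case
  1 by a dilation of the argument.\<close>

lemma ext_inv_scale:
  assumes "c > 0" shows "ext_inv (\<lambda>v. c * g v) \<rho> = ext_inv g (\<rho> / c)"
  unfolding ext_inv_def using assms by (simp add: pos_divide_less_eq mult.commute)

text \<open>The region under the graph is covered by the dyadic rectangles with base
  \<open>{0..g (v i)}\<close> and height \<open>2 * v i\<close>, whose total area is twice the given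
  sum.\<close>

lemma ext_inv_integrable:
  assumes pos: "\<And>v. v \<in> {0<..1} \<Longrightarrow> g v > 0" and decr: "strict_antimono_on {0<..1} g"
    and sum: "summable (\<lambda>i. (1 / 2) ^ Suc i * g ((1 / 2) ^ Suc i))"
  shows "set_integrable lborel {0..} (ext_inv g)"
proof -
  define v :: "nat \<Rightarrow> real" where "v i = (1 / 2) ^ Suc i" for i
  have v: "v i \<in> {0<..1}" for i
    by (auto simp: v_def power_le_one mult_le_one simp del: power_Suc)
  have dom: "ennreal (indicator {0..} t * ext_inv g t) \<le> (\<Sum>i. ennreal (2 * v i) * indicator {0..g (v i)} t)" for t
  proof (cases "t \<ge> 0 \<and> ext_inv g t > 0")
    case True
    \<comment> \<open>For \<open>n = Suc i\<close> minimality gives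
      \<open>v i < ext_inv g t \<le> 2 * v i\<close>; the case \<open>n = 0\<close> is excluded by
      \<open>ext_inv_le_1\<close>.\<close>
    define n where "n = (LEAST n. (1 / 2) ^ n < ext_inv g t)"
    have ex: "\<exists>n. (1 / 2) ^ n < ext_inv g t" using True by (intro real_arch_pow_inv) auto
    have n: "(1 / 2) ^ n < ext_inv g t" unfolding n_def using ex by (rule LeastI_ex)
    have "n \<noteq> 0" using n ext_inv_le_1[of g t] by (intro notI) simp
    then obtain i where i: "n = Suc i" by (cases n) auto
    have "\<not> (1 / 2) ^ i < ext_inv g t"
      using not_less_Least[of i "\<lambda>n. (1 / 2) ^ n < ext_inv g t"] i by (simp add: n_def)
    then have le: "ext_inv g t \<le> 2 * v i" by (simp add: v_def)
    have "v i < ext_inv g t" using n i by (simp add: v_def)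
    then obtain w where w: "w \<in> {0} \<union> {v \<in> {0<..1}. g v > t}" "v i < w"
      unfolding ext_inv_def by (subst (asm) less_cSup_iff) auto
    then have "w \<in> {0<..1}" "g w > t" using v[of i] by auto
    then have "t < g (v i)"
      using monotone_onD[OF decr v[of i], of w] w(2) by auto
    then have "ennreal (indicator {0..} t * ext_inv g t) \<le> ennreal (2 * v i) * indicator {0..g (v i)} t"
      using True le by (simp add: ennreal_leI)
    also have "\<dots> = (\<Sum>j\<in>{i}. ennreal (2 * v j) * indicator {0..g (v j)} t)"
      by (subst sum.insert) auto
    also have "\<dots> \<le> (\<Sum>j. ennreal (2 * v j) * indicator {0..g (v j)} t)"
      by (rule sum_le_suminf) auto
    finally show ?thesis .
  next
    case False
    then have 0: "indicator {0..} t * ext_inv g t = 0"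
      using ext_inv_nonneg[of g t] by (auto simp: indicator_def)
    show ?thesis by (simp only: 0 ennreal_0 zero_le)
  qed
  have "(\<integral>\<^sup>+t. ennreal (norm (indicator {0..} t *\<^sub>R ext_inv g t)) \<partial>lborel)
      \<le> (\<integral>\<^sup>+t. (\<Sum>i. ennreal (2 * v i) * indicator {0..g (v i)} t) \<partial>lborel)"
    using dom ext_inv_nonneg[of g] by (intro nn_integral_mono) simp
  also have "\<dots> = (\<Sum>i. ennreal (2 * v i) * ennreal (g (v i)))"
    using pos v by (subst nn_integral_suminf) (auto simp: nn_integral_cmult less_imp_le)
  also have "\<dots> = (\<Sum>i. ennreal (2 * (v i * g (v i))))"
    using pos v by (intro suminf_cong) (auto simp: ennreal_mult[symmetric] less_imp_le mult.assoc)
  also have "\<dots> < \<infinity>"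
  proof -
    have "summable (\<lambda>i. 2 * (v i * g (v i)))"
      unfolding v_def by (rule summable_mult[OF sum])
    moreover have "0 \<le> 2 * (v i * g (v i))" for i
      using pos[OF v[of i]] v[of i] by simp
    ultimately show ?thesis
      by (subst suminf_ennreal2) auto
  qed
  finally show ?thesis
    unfolding set_integrable_def by (intro integrableI_bounded) auto
qed

subsection \<open>The finite constellation\<close>

text \<open>The likelihood ratio of the observation \<open>y = a s + w\<close> against the pure noise \<open>w\<close>.\<close>

definition const_lik :: "real \<Rightarrow> real \<Rightarrow> real \<Rightarrow> real" where
  "const_lik a s y = exp ((2 * y * (a * s) - (a * s)\<^sup>2) / 2)"

text \<open>The posterior mean of \<open>s\<close>; the equal prior weights cancel from the
  quotient.\<close>

definition const_post :: "real set \<Rightarrow> real \<Rightarrow> real \<Rightarrow> real" where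
  "const_post S a y = (\<Sum>s\<in>S. s * const_lik a s y) / (\<Sum>s\<in>S. const_lik a s y)"

context
  fixes S :: "real set"
  assumes S_fin: "finite S" and S_ne: "S \<noteq> {}"
begin

lemma const_lik_sum_pos: "(\<Sum>s\<in>S. const_lik a s y) > 0"
  using S_fin S_ne by (intro sum_pos) (auto simp: const_lik_def)

text \<open>A weighted average of the points of \<open>S\<close> is bounded uniformly in
  \<open>a\<close> and \<open>y\<close>, as dominated convergence in the signal-to-noise ratio
  requires.\<close>

lemma const_post_bound: "\<bar>const_post S a y\<bar> \<le> (\<Sum>s\<in>S. \<bar>s\<bar>)"
proof -
  have "\<bar>\<Sum>s\<in>S. s * const_lik a s y\<bar> \<le> (\<Sum>s\<in>S. \<bar>s * const_lik a s y\<bar>)" by (rule sum_abs)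
  also have "\<dots> \<le> (\<Sum>s\<in>S. (\<Sum>s\<in>S. \<bar>s\<bar>) * const_lik a s y)"
    using S_fin by (intro sum_mono) (auto simp: abs_mult const_lik_def intro!: mult_right_mono member_le_sum)
  also have "\<dots> = (\<Sum>s\<in>S. \<bar>s\<bar>) * (\<Sum>s\<in>S. const_lik a s y)" by (simp add: sum_distrib_left)
  finally show ?thesis
    using const_lik_sum_pos[of a y] by (simp add: const_post_def pos_divide_le_eq)
qed

lemma const_post_measurable [measurable (raw)]:
  assumes [measurable]: "g \<in> borel_measurable M"
  shows "(\<lambda>x. const_post S a (g x)) \<in> borel_measurable M"
  unfolding const_post_def const_lik_def by measurable

lemma const_fst_measurable [measurable]:
  "fst \<in> borel_measurable (measure_pmf (pmf_of_set S) \<Otimes>\<^sub>M gauss s)"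
  by (rule measurable_compose[OF measurable_fst]) simp

lemma const_bayes_kernel: "bayes_kernel (measure_pmf (pmf_of_set S)) (gauss 1) (const_lik a) (\<lambda>s. s)"
proof -
  interpret G: prob_space "gauss 1" by (simp add: prob_space_gauss)
  show ?thesis
  proof unfold_locales
    show "(\<lambda>(t, z). const_lik a t z) \<in> borel_measurable (measure_pmf (pmf_of_set S) \<Otimes>\<^sub>M gauss 1)"
      unfolding const_lik_def case_prod_beta' by measurable
    show "const_lik a t z > 0" for t z by (simp add: const_lik_def)
    show "\<exists>c. \<forall>t. const_lik a t z \<le> c" for z
    proof (intro exI allI)
      show "const_lik a t z \<le> exp (z\<^sup>2 / 2)" for t
        using zero_le_power2[of "z - a * t"] by (simp add: const_lik_def power2_diff)
    qed
    show "(\<integral>\<^sup>+z. ennreal (const_lik a t z) \<partial>gauss 1) = 1" for t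
      using gauss_shift[of 1 "\<lambda>_. 1" "a * t"] by (simp add: const_lik_def)
    show "integrable (measure_pmf (pmf_of_set S)) (\<lambda>t. t\<^sup>2)"
      using S_fin S_ne by (intro integrable_measure_pmf_finite) simp
  qed simp
qed

lemma const_bayes_model:
  "bayes_model (measure_pmf (pmf_of_set S)) (gauss 1) (const_lik a) (\<lambda>s. s)
    (const_space S) fst (\<lambda>\<omega>. a * fst \<omega> + snd \<omega>)"
proof (intro bayes_model.intro bayes_model_axioms.intro const_bayes_kernel)
  interpret K: bayes_kernel "measure_pmf (pmf_of_set S)" "gauss 1" "const_lik a" "\<lambda>s. s"
    by (rule const_bayes_kernel)
  interpret PP: pair_prob_space "measure_pmf (pmf_of_set S)" "gauss 1" ..
  show "prob_space (const_space S)" unfolding const_space_def by (rule PP.prob_space_axioms)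
  show "fst \<in> const_space S \<rightarrow>\<^sub>M measure_pmf (pmf_of_set S)"
    unfolding const_space_def by measurable
  show "(\<lambda>\<omega>. a * fst \<omega> + snd \<omega>) \<in> const_space S \<rightarrow>\<^sub>M gauss 1"
    unfolding const_space_def by measurable
  fix h :: "real \<times> real \<Rightarrow> ennreal"
  assume h[measurable]: "h \<in> borel_measurable (measure_pmf (pmf_of_set S) \<Otimes>\<^sub>M gauss 1)"
  have [measurable]: "(\<lambda>y. h (s, y)) \<in> borel_measurable borel" for s
  proof -
    have "(\<lambda>y. (s, y)) \<in> borel \<rightarrow>\<^sub>M measure_pmf (pmf_of_set S) \<Otimes>\<^sub>M gauss 1" by measurable
    from measurable_compose[OF this h] show ?thesis .
  qed
  have "(\<integral>\<^sup>+\<omega>. h (fst \<omega>, a * fst \<omega> + snd \<omega>) \<partial>const_space S)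
      = (\<integral>\<^sup>+s. \<integral>\<^sup>+w. h (s, a * s + w) \<partial>gauss 1 \<partial>measure_pmf (pmf_of_set S))"
    unfolding const_space_def by (subst K.B.nn_integral_fst[symmetric]) (auto simp: measurable_split_conv)
  also have "\<dots> = (\<integral>\<^sup>+s. \<integral>\<^sup>+y. h (s, y) * ennreal (const_lik a s y) \<partial>gauss 1 \<partial>measure_pmf (pmf_of_set S))"
    by (subst gauss_shift) (auto simp: const_lik_def mult.commute)
  also have "\<dots> = (\<integral>\<^sup>+y. \<integral>\<^sup>+s. h (s, y) * ennreal (const_lik a s y) \<partial>measure_pmf (pmf_of_set S) \<partial>gauss 1)"
    by (rule K.P.Fubini'[symmetric]) (unfold const_lik_def case_prod_beta' prod.collapse, measurable)
  finally show "(\<integral>\<^sup>+\<omega>. h (fst \<omega>, a * fst \<omega> + snd \<omega>) \<partial>const_space S)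
      = (\<integral>\<^sup>+y. \<integral>\<^sup>+s. h (s, y) * ennreal (const_lik a s y) \<partial>measure_pmf (pmf_of_set S) \<partial>gauss 1)" .
qed

text \<open>Removes the conditional expectation: on the right, \<rho> enters through an explicit
  integrand rather than through a sigma-algebra, so limits in \<rho> can be taken.\<close>

lemma mmse_const_eq:
  "mmse_const S \<rho> = (\<integral>\<omega>. (fst \<omega> - const_post S (sqrt \<rho>) (sqrt \<rho> * fst \<omega> + snd \<omega>))\<^sup>2 \<partial>const_space S)"
proof -
  let ?a = "sqrt \<rho>"
  interpret bayes_model "measure_pmf (pmf_of_set S)" "gauss 1" "const_lik ?a" "\<lambda>s. s"
    "const_space S" fst "\<lambda>\<omega>. ?a * fst \<omega> + snd \<omega>"
    by (rule const_bayes_model)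
  have post: "N y / q y = const_post S ?a y" for y
    using S_fin S_ne by (simp add: N_def q_def const_post_def integral_pmf_of_set)
  have ae: "AE \<omega> in const_space S. (fst \<omega> - real_cond_exp (const_space S)
       (gen_alg (const_space S) (\<lambda>\<omega>. ?a * fst \<omega> + snd \<omega>) borel) fst \<omega>)\<^sup>2
      = (fst \<omega> - const_post S ?a (?a * fst \<omega> + snd \<omega>))\<^sup>2"
    using posterior_mean[of borel] unfolding post by (auto elim!: eventually_mono)
  show ?thesis
    unfolding mmse_const_def Let_def
    by (intro integral_cong_AE[OF _ _ ae] borel_measurable_power borel_measurable_diff
        borel_measurable_cond_exp2 borel_measurable_integrable[OF U_T_int]
        borel_measurable_integrable[OF posterior_mean_int, unfolded post])
qed

text \<open>Dominated convergence: \<open>sqrt\<close> is continuous on all reals, so the explicit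
  integrand is continuous in \<rho> at each outcome, and \<open>const_post_bound\<close> supplies
  the dominating function.\<close>

lemma continuous_mmse_const: "continuous_on UNIV (mmse_const S)"
proof (intro continuous_at_imp_continuous_on ballI continuous_at_sequentiallyI)
  fix r :: real and X :: "nat \<Rightarrow> real"
  assume X: "X \<longlonglongrightarrow> r"
  interpret G: prob_space "gauss 1" by (simp add: prob_space_gauss)
  interpret M: prob_space "const_space S"
    using const_bayes_model[of 0] by (simp add: bayes_model_def)
  let ?F = "\<lambda>\<rho> \<omega>. (fst \<omega> - const_post S (sqrt \<rho>) (sqrt \<rho> * fst \<omega> + snd \<omega>))\<^sup>2 :: real"
  let ?B = "\<Sum>s\<in>S. \<bar>s\<bar>"
  have meas: "?F \<rho> \<in> borel_measurable (const_space S)" for \<rho>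
    unfolding const_space_def by measurable
  have sq: "integrable (const_space S) (\<lambda>\<omega>. (fst \<omega>)\<^sup>2)"
  proof -
    have "integrable (distr (const_space S) (measure_pmf (pmf_of_set S)) fst) (\<lambda>s. s\<^sup>2)"
      unfolding const_space_def G.distr_pair_fst using S_fin S_ne by (intro integrable_measure_pmf_finite) simp
    then show ?thesis by (subst (asm) integrable_distr_eq) (auto simp: const_space_def)
  qed
  have "(\<lambda>i. \<integral>\<omega>. ?F (X i) \<omega> \<partial>const_space S) \<longlonglongrightarrow> (\<integral>\<omega>. ?F r \<omega> \<partial>const_space S)"
  proof (rule integral_dominated_convergence[where w = "\<lambda>\<omega>. 2 * (fst \<omega>)\<^sup>2 + 2 * ?B\<^sup>2"])
    show "AE \<omega> in const_space S. (\<lambda>i. ?F (X i) \<omega>) \<longlonglongrightarrow> ?F r \<omega>"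
    proof (rule AE_I2)
      fix \<omega> :: "real \<times> real"
      have "(\<Sum>s\<in>S. const_lik (sqrt r) s (sqrt r * fst \<omega> + snd \<omega>)) \<noteq> 0"
        using const_lik_sum_pos by (metis less_irrefl)
      then show "(\<lambda>i. ?F (X i) \<omega>) \<longlonglongrightarrow> ?F r \<omega>"
        unfolding const_post_def const_lik_def by (intro tendsto_intros X) simp_all
    qed
    show "AE \<omega> in const_space S. norm (?F (X i) \<omega>) \<le> 2 * (fst \<omega>)\<^sup>2 + 2 * ?B\<^sup>2" for i
    proof (rule AE_I2)
      fix \<omega> :: "real \<times> real"
      let ?p = "const_post S (sqrt (X i)) (sqrt (X i) * fst \<omega> + snd \<omega>)"
      have "?p\<^sup>2 \<le> ?B\<^sup>2" using const_post_bound by (metis abs_ge_zero power2_abs power_mono)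
      moreover have "?F (X i) \<omega> \<le> 2 * (fst \<omega>)\<^sup>2 + 2 * ?p\<^sup>2"
        using zero_le_power2[of "fst \<omega> + ?p"] by (simp add: power2_sum power2_diff)
      ultimately show "norm (?F (X i) \<omega>) \<le> 2 * (fst \<omega>)\<^sup>2 + 2 * ?B\<^sup>2" by simp
    qed
  qed (use meas sq in auto)
  then show "(\<lambda>i. mmse_const S (X i)) \<longlonglongrightarrow> mmse_const S r"
    by (simp add: mmse_const_eq)
qed

lemma mmse_const_nonneg: "mmse_const S \<rho> \<ge> 0"
  by (simp add: mmse_const_eq)

text \<open>At ratio zero the observation is pure noise, so the posterior is the prior; symmetry
  makes its mean 0 and the power normalisation makes its second moment 1.\<close>

lemma mmse_const_0:
  assumes sym: "\<And>s. s \<in> S \<Longrightarrow> - s \<in> S" and power: "(\<Sum>s\<in>S. s\<^sup>2) / real (card S) = 1"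
  shows "mmse_const S 0 = 1"
proof -
  interpret G: prob_space "gauss 1" by (simp add: prob_space_gauss)
  have "(\<Sum>s\<in>S. s) = (\<Sum>s\<in>S. - s)"
    by (rule sum.reindex_bij_witness[of _ uminus uminus]) (auto simp: sym)
  then have "(\<Sum>s\<in>S. s) = 0" by (simp add: sum_negf)
  then have "const_post S 0 y = 0" for y by (simp add: const_post_def const_lik_def)
  then have "mmse_const S 0 = (\<integral>\<omega>. (fst \<omega>)\<^sup>2 \<partial>const_space S)"
    by (simp add: mmse_const_eq)
  also have "\<dots> = (\<integral>s. s\<^sup>2 \<partial>distr (const_space S) (measure_pmf (pmf_of_set S)) fst)"
    by (subst integral_distr) (auto simp: const_space_def)
  also have "\<dots> = (\<integral>s. s\<^sup>2 \<partial>measure_pmf (pmf_of_set S))"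
    unfolding const_space_def G.distr_pair_fst ..
  also have "\<dots> = 1"
    unfolding integral_pmf_of_set[OF S_ne S_fin] by (rule power)
  finally show ?thesis .
qed

end

subsection \<open>The limit of vanishing rate\<close>

lemma phi_scale: "phi \<sigma> f \<delta> = (\<lambda>v. \<delta> * phi \<sigma> f 1 v)"
  by (simp add: phi_def fun_eq_iff)

text \<open>The integrability clause excludes the default value 0 that the Bochner integral in
  \<open>a_f\<close> takes on a non-integrable function.\<close>

theorem theorem5:
  fixes \<sigma> :: real and f :: "real \<Rightarrow> real" and S :: "real set"
  assumes sigma_pos: "\<sigma> > 0"
    and f_meas: "f \<in> borel_measurable borel"
    and f_int: "integrable (gauss 1) (\<lambda>x. (f x)\<^sup>2)"
    and f_power: "(\<integral>x. (f x)\<^sup>2 \<partial>gauss 1) = 1"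
    and phi_pos: "\<And>\<delta> v. \<delta> > 0 \<Longrightarrow> v \<in> {0<..1} \<Longrightarrow> phi \<sigma> f \<delta> v > 0"
    and phi_decr: "\<And>\<delta>. \<delta> > 0 \<Longrightarrow> strict_antimono_on {0<..1} (phi \<sigma> f \<delta>)"
    and S_fin: "finite S" and S_ne: "S \<noteq> {}"
    and S_sym: "\<And>s. s \<in> S \<Longrightarrow> - s \<in> S"
    and S_power: "(\<Sum>s\<in>S. s\<^sup>2) / real (card S) = 1"
  shows "(\<forall>\<^sub>F \<delta> in at_right 0. set_integrable lborel {0..} (a_integrand \<sigma> f S \<delta>))
         \<and> ((\<lambda>\<delta>. R_AC \<sigma> f S \<delta>) \<longlongrightarrow> mi_yx \<sigma> f) (at_right 0)"
proof -
  interpret gauss_channel \<sigma> f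
    using sigma_pos f_meas f_int by unfold_locales
  define g where "g = ext_inv (phi \<sigma> f 1)"
  define m where "m = mmse_const S"
  \<comment> \<open>The integrand after the substitution \<open>\<rho> = \<delta> * t\<close>; it is
    dominated by \<open>g\<close> on the half-line, independently of \<delta>.\<close>
  define D where "D \<delta> t = indicator {0..} t * (g t - min (g t) (m (\<delta> * t)))" for \<delta> t :: real
  have g_int: "integrable lborel (\<lambda>t. indicator {0..} t * g t)"
    using ext_inv_integrable[of "phi \<sigma> f 1", OF _ phi_decr phi_dyadic_summable] phi_pos
    by (simp add: g_def set_integrable_def)
  have g01: "0 \<le> g t" "g t \<le> 1" for t
    by (simp_all add: g_def ext_inv_nonneg ext_inv_le_1)
  have m_cont: "continuous_on UNIV m"
    unfolding m_def by (rule continuous_mmse_const[OF S_fin S_ne])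
  have m0: "m \<rho> \<ge> 0" for \<rho>
    unfolding m_def by (rule mmse_const_nonneg[OF S_fin S_ne])
  have m_at_0: "m 0 = 1"
    unfolding m_def by (rule mmse_const_0[OF S_fin S_ne S_sym S_power])
  have [measurable]: "g \<in> borel_measurable borel" "m \<in> borel_measurable borel"
    using borel_measurable_continuous_onI[OF m_cont] by (simp_all add: g_def)
  have D_meas: "D \<delta> \<in> borel_measurable lborel" for \<delta>
    unfolding D_def by measurable
  have D_bound: "norm (D \<delta> t) \<le> indicator {0..} t * g t" for \<delta> t
    using g01[of t] m0[of "\<delta> * t"] by (auto simp: D_def indicator_def)
  have D_int: "integrable lborel (D \<delta>)" for \<delta>
    by (rule Bochner_Integration.integrable_bound[OF g_int D_meas])
       (use D_bound in \<open>auto intro: order_trans[OF _ abs_ge_self]\<close>)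
  \<comment> \<open>The form \<open>0 + \<delta> * t\<close> matches the affine substitution rules
    for \<open>lborel\<close>.\<close>
  have a_D: "indicator {0..} (0 + \<delta> * t) *\<^sub>R a_integrand \<sigma> f S \<delta> (0 + \<delta> * t) = D \<delta> t"
    if "\<delta> > 0" for \<delta> t
  proof -
    have "ext_inv (phi \<sigma> f \<delta>) (\<delta> * t) = g t"
      using that by (simp add: phi_scale[of \<sigma> f \<delta>] ext_inv_scale g_def)
    moreover have "indicator {0..} (\<delta> * t) = (indicator {0..} t :: real)"
      using that by (auto simp: indicator_def zero_le_mult_iff)
    ultimately show ?thesis
      by (simp add: a_integrand_def psi_opt_def D_def m_def)
  qed
  have a_int: "set_integrable lborel {0..} (a_integrand \<sigma> f S \<delta>)" if "\<delta> > 0" for \<delta>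
  proof -
    have "integrable lborel (\<lambda>t. indicator {0..} (0 + \<delta> * t) *\<^sub>R a_integrand \<sigma> f S \<delta> (0 + \<delta> * t))"
      unfolding a_D[OF that] by (rule D_int)
    then show ?thesis
      unfolding set_integrable_def using that
      by (subst (asm) lborel_integrable_real_affine_iff) auto
  qed
  have a_f: "a_f \<sigma> f S \<delta> = \<delta> * (\<integral>t. D \<delta> t \<partial>lborel)" if "\<delta> > 0" for \<delta>
    unfolding a_f_def set_lebesgue_integral_def using that
    by (subst lborel_integral_real_affine[where c = \<delta> and t = 0]) (simp_all only: a_D[OF that], simp_all)
  have D_lim: "((\<lambda>\<delta>. \<integral>t. D \<delta> t \<partial>lborel) \<longlongrightarrow> 0) (at_right 0)"
    unfolding tendsto_at_iff_sequentially
  proof (intro allI impI)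
    fix X :: "nat \<Rightarrow> real" assume X: "X \<longlonglongrightarrow> 0"
    have "(\<lambda>i. \<integral>t. D (X i) t \<partial>lborel) \<longlonglongrightarrow> (\<integral>t. 0 \<partial>(lborel :: real measure))"
    proof (rule integral_dominated_convergence[where w = "\<lambda>t. indicator {0..} t * g t"])
      show "AE t in lborel. (\<lambda>i. D (X i) t) \<longlonglongrightarrow> 0"
      proof (rule AE_I2)
        fix t :: real
        have "(\<lambda>i. m (X i * t)) \<longlonglongrightarrow> m (0 * t)"
          by (rule continuous_on_tendsto_compose[OF m_cont tendsto_mult[OF X tendsto_const]]) auto
        \<comment> \<open>The limit vanishes because an extended inverse never exceeds 1, so
          \<open>min (g t) 1 = g t\<close>.\<close>
        then have "(\<lambda>i. D (X i) t) \<longlonglongrightarrow> indicator {0..} t * (g t - min (g t) 1)"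
          unfolding D_def by (intro tendsto_intros) (simp add: m_at_0)
        then show "(\<lambda>i. D (X i) t) \<longlonglongrightarrow> 0" using g01[of t] by (simp add: min_def)
      qed
    qed (use D_bound D_meas g_int in auto)
    then show "((\<lambda>\<delta>. \<integral>t. D \<delta> t \<partial>lborel) \<circ> X) \<longlonglongrightarrow> 0" by (simp add: o_def)
  qed
  have "((\<lambda>\<delta>. mi_yx \<sigma> f - (\<integral>t. D \<delta> t \<partial>lborel) / 2) \<longlongrightarrow> mi_yx \<sigma> f - 0 / 2) (at_right 0)"
    by (intro tendsto_intros D_lim) simp
  moreover have "\<forall>\<^sub>F \<delta> in at_right 0. mi_yx \<sigma> f - (\<integral>t. D \<delta> t \<partial>lborel) / 2 = R_AC \<sigma> f S \<delta>"
    using eventually_at_right_less[of 0] by eventually_elim (simp add: R_AC_def a_f)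
  ultimately have "((\<lambda>\<delta>. R_AC \<sigma> f S \<delta>) \<longlongrightarrow> mi_yx \<sigma> f) (at_right 0)"
    by (auto intro: Lim_transform_eventually)
  moreover have "\<forall>\<^sub>F \<delta> in at_right 0. set_integrable lborel {0..} (a_integrand \<sigma> f S \<delta>)"
    using eventually_at_right_less[of 0] by eventually_elim (rule a_int)
  ultimately show ?thesis by blast
qed

end
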